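(* Let $D\subseteq\mathbb{C}$ be a domain, let $a_1,a_2,a_3,a_4\in\mathbb{C}_\infty$ be four distinct values, and let $\mathcal{F}$ and $\mathcal{G}$ be two families of meromorphic functions on $D$ such that, for each $f\in\mathcal{F}$, every $a_1$-point of $f$ has multiplicity at least $2$. Suppose that $\mathcal{G}$ is normal in $D$. If for each $f\in\mathcal{F}$ there exists $g\in\mathcal{G}$ such that $f$ and $g$ share $a_j$ partially in $D$ for each $j=2,3,4$, then $\mathcal{F}$ is normal in $D$.
   Context: $\mathbb{C}_\infty=\mathbb{C}\cup\{\infty\}$ is the extended complex plane. A family of meromorphic functions on $D$ is normal in $D$ if every sequence in the family has a subsequence converging spherically locally uniformly in $D$; the limit is either a meromorphic function on $D$ or identically equal to $\infty$. For a meromorphic function $f$ on $D$ and $a\in\mathbb{C}_\infty$, an $a$-point of $f$ is a point $z\in D$ with $f(z)=a$, and $\bar{E}(f,a)=\{z\in D: f(z)=a\}$ (multiplicities ignored). Two meromorphic functions $f,g$ on $D$ are said to share $a$ partially if $\bar{E}(f,a)\subseteq\bar{E}(g,a)$ (in this order: every $a$-point of $f$ is an $a$-point of $g$). *)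

theory Defs
  imports "HOL-Complex_Analysis.Complex_Analysis" "HOL-Library.Extended_Nat"
begin

text \<open>
  The extended plane is \<^typ>\<open>complex option\<close>, with \<^term>\<open>None\<close> as the point at infinity.
  A meromorphic function on an open set \<open>D\<close> is a function that is \<open>nicely_meromorphic_on D\<close>:
  all removable singularities are filled in, and at a pole the function has the dummy
  value \<open>0\<close>. Its true value there is infinity, so the map into the extended plane that
  such a function stands for is \<open>ext_val f\<close>.
\<close>

definition ext_val :: "(complex \<Rightarrow> complex) \<Rightarrow> complex \<Rightarrow> complex option" where
  "ext_val f z = (if is_pole f z then None else Some (f z))"

definition apoints :: "complex set \<Rightarrow> (complex \<Rightarrow> complex) \<Rightarrow> complex option \<Rightarrow> complex set" where
  "apoints D f a = {z \<in> D. ext_val f z = a}"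

text \<open>
  Multiplicity of \<open>z\<close> as an \<open>a\<close>-point of \<open>f\<close>. It is infinite where \<open>f\<close> is locally constant,
  a case in which \<^const>\<open>zorder\<close> is unspecified.
\<close>

definition apoint_mult :: "(complex \<Rightarrow> complex) \<Rightarrow> complex option \<Rightarrow> complex \<Rightarrow> enat" where
  "apoint_mult f a z =
    (if ext_val f z \<noteq> a then 0
     else case a of
       None \<Rightarrow> enat (nat (- zorder f z))
     | Some c \<Rightarrow>
         if eventually (\<lambda>w. f w = c) (at z) then \<infinity>
         else enat (nat (zorder (\<lambda>w. f w - c) z)))"

definition share_partially ::
  "complex set \<Rightarrow> (complex \<Rightarrow> complex) \<Rightarrow> (complex \<Rightarrow> complex) \<Rightarrow> complex option \<Rightarrow> bool" where
  "share_partially D f g a \<longleftrightarrow> apoints D f a \<subseteq> apoints D g a"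

text \<open>The chordal metric: Euclidean distance of the stereographic images on the unit sphere.\<close>

fun chordal :: "complex option \<Rightarrow> complex option \<Rightarrow> real" where
  "chordal (Some z) (Some w) =
     2 * norm (z - w) / (sqrt (1 + (norm z)\<^sup>2) * sqrt (1 + (norm w)\<^sup>2))"
| "chordal (Some z) None = 2 / sqrt (1 + (norm z)\<^sup>2)"
| "chordal None (Some w) = 2 / sqrt (1 + (norm w)\<^sup>2)"
| "chordal None None = 0"

definition spherically_loc_unif_limit ::
  "complex set \<Rightarrow> (nat \<Rightarrow> complex \<Rightarrow> complex option) \<Rightarrow> (complex \<Rightarrow> complex option) \<Rightarrow> bool" where
  "spherically_loc_unif_limit D F h \<longleftrightarrow>
    (\<forall>z\<in>D. \<exists>r>0.
       uniform_limit (ball z r \<inter> D) (\<lambda>n w. chordal (F n w) (h w)) (\<lambda>_. 0) sequentially)"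

definition normal_family :: "complex set \<Rightarrow> (complex \<Rightarrow> complex) set \<Rightarrow> bool" where
  "normal_family D \<F> \<longleftrightarrow>
    (\<forall>f :: nat \<Rightarrow> complex \<Rightarrow> complex. range f \<subseteq> \<F> \<longrightarrow>
      (\<exists>(k :: nat \<Rightarrow> nat) h. strict_mono k \<and>
         ((\<exists>g. g nicely_meromorphic_on D \<and> h = ext_val g) \<or> h = (\<lambda>_. None)) \<and>
         spherically_loc_unif_limit D (\<lambda>n. ext_val (f (k n))) h))"

end

theory Submission
  imports Defs
begin

text \<open>
  Near a point \<open>z0\<close>, a subsequence of the partners \<open>g\<close> converges spherically, and its limit
  differs from at least two of \<open>a2, a3, a4\<close>; hence the functions \<open>f\<close> omit two values \<open>b, c\<close>
  near \<open>z0\<close>, while their \<open>a1\<close>-points are multiple. After a Moebius map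
  \<open>(a1, b, c) \<mapsto> (1, 0, \<infinity>)\<close> they become \<open>exp G\<close> with \<open>G' = 0\<close> wherever \<open>exp G = 1\<close>.

  The heart of the proof is the bound \<open>|G'| \<le> C cosh (Re G)\<close> at the centre of the unit disc,
  which bounds the spherical derivative of \<open>exp G\<close>. If it failed, Zalcman's rescaling would
  give such a \<open>G\<close> on a huge disc with \<open>|G'| \<le> 4 cosh (Re G)\<close> and \<open>|G'(0)| = 2 cosh (Re G(0))\<close>.
  On the zero set of \<open>Re G\<close> this says \<open>|G'| \<le> 4\<close>, so by Hopf's boundary lemma \<open>Re G\<close> grows at
  most linearly, \<open>G'\<close> is bounded, and \<open>G\<close> is nearly affine with slope at least \<open>2\<close> around \<open>0\<close>.
  Such a \<open>G\<close> takes a value in \<open>2 \<pi> i \<int>\<close> at a point where \<open>G' \<noteq> 0\<close>, a contradiction.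
  No attempt is made to obtain good constants.
\<close>

section \<open>Harmonic estimates\<close>

text \<open>The quotient is the Cayley map of the right half plane onto the unit disc that sends
  \<open>b\<close> to \<open>0\<close>. Everything follows from
  \<open>|a + cnj b|^2 - |a - b|^2 = 4 Re a Re b\<close>; the last claim is Harnack's inequality in
  terms of the pseudohyperbolic distance of \<open>a\<close> and \<open>b\<close>.\<close>

lemma right_half_plane_quotient_bound:
  fixes a b :: complex
  assumes ab: "Re a > 0" "Re b > 0"
  shows "a + cnj b \<noteq> 0" "norm ((a - b) / (a + cnj b)) < 1"
    and "norm ((a - b) / (a + cnj b)) \<le> t \<Longrightarrow> t \<le> 1 \<Longrightarrow> Re b * (1 - t) \<le> Re a * (1 + t)"
proof -
  show nz: "a + cnj b \<noteq> 0"
    using ab by (auto simp: complex_eq_iff)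
  have sq: "(norm (a - b))\<^sup>2 = (norm (a + cnj b))\<^sup>2 - 4 * Re a * Re b"
    by (simp add: cmod_power2 power2_diff power2_sum)
  have "(norm (a - b))\<^sup>2 < (norm (a + cnj b))\<^sup>2"
    unfolding sq using ab by simp
  then have "norm (a - b) < norm (a + cnj b)"
    by (rule power_less_imp_less_base) simp
  then show "norm ((a - b) / (a + cnj b)) < 1"
    using nz by (simp add: norm_divide)
  assume *: "norm ((a - b) / (a + cnj b)) \<le> t" and t1: "t \<le> 1"
  have t0: "t \<ge> 0" using * norm_ge_zero order_trans by blast
  have "norm (a - b) \<le> t * norm (a + cnj b)"
    using * nz by (simp add: norm_divide divide_simps mult.commute)
  then have "(norm (a - b))\<^sup>2 \<le> t\<^sup>2 * (norm (a + cnj b))\<^sup>2"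
    using power_mono[of "norm (a - b)" "t * norm (a + cnj b)" 2] by (simp add: power_mult_distrib)
  then have "(Re a - Re b)\<^sup>2 + (Im a - Im b)\<^sup>2 \<le> t\<^sup>2 * (Re a + Re b)\<^sup>2 + t\<^sup>2 * (Im a - Im b)\<^sup>2"
    by (simp add: cmod_power2 algebra_simps)
  \<comment> \<open>As \<open>t \<le> 1\<close>, the imaginary parts cancel in favour of an
    inequality between real parts only.\<close>
  moreover have "t\<^sup>2 * (Im a - Im b)\<^sup>2 \<le> 1 * (Im a - Im b)\<^sup>2"
    using t0 t1 by (intro mult_right_mono) (auto simp: power_le_one)
  ultimately have "(Re a - Re b)\<^sup>2 \<le> (t * (Re a + Re b))\<^sup>2"
    by (simp add: power_mult_distrib)
  then have "\<bar>Re a - Re b\<bar> \<le> t * (Re a + Re b)"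
    using ab t0 by (simp add: abs_le_square_iff[symmetric])
  then show "Re b * (1 - t) \<le> Re a * (1 + t)"
    by (auto simp: algebra_simps)
qed

text \<open>Schwarz's lemma for the Cayley transform \<phi> of \<open>G\<close>, rescaled to the
  unit disc. The bound on \<open>deriv \<phi> 0\<close> gives the gradient estimate, and
  \<open>|\<phi> \<zeta>| \<le> |\<zeta>|\<close> gives Harnack's lower bound.\<close>

lemma positive_real_part_estimates:
  assumes hol: "G holomorphic_on ball z0 r" and r: "r > 0"
    and pos: "\<And>z. z \<in> ball z0 r \<Longrightarrow> Re (G z) > 0"
  shows "norm (deriv G z0) \<le> 2 * Re (G z0) / r"
    and "z \<in> ball z0 r \<Longrightarrow> Re (G z0) * (r - dist z0 z) \<le> Re (G z) * (r + dist z0 z)"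
proof -
  define b where "b = G z0"
  define h where "h = (\<lambda>\<zeta>. G (z0 + of_real r * \<zeta>))"
  define \<phi> where "\<phi> = (\<lambda>\<zeta>. (h \<zeta> - b) / (h \<zeta> + cnj b))"
  have inb: "z0 + of_real r * \<zeta> \<in> ball z0 r" if "norm \<zeta> < 1" for \<zeta>
    using that r by (simp add: dist_norm norm_mult)
  have b: "Re b > 0" using pos r by (simp add: b_def)
  have hpos: "Re (h \<zeta>) > 0" if "norm \<zeta> < 1" for \<zeta>
    using pos[OF inb[OF that]] by (simp add: h_def)
  have holh: "h holomorphic_on ball 0 1"
    unfolding h_def
    by (rule holomorphic_on_compose_gen[OF _ hol, unfolded o_def])
       (use inb in \<open>auto intro!: holomorphic_intros\<close>)
  have hol\<phi>: "\<phi> holomorphic_on ball 0 1"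
    unfolding \<phi>_def using holh
    by (intro holomorphic_intros) (use right_half_plane_quotient_bound(1) hpos b in auto)
  have \<phi>0: "\<phi> 0 = 0" by (simp add: \<phi>_def h_def b_def)
  have \<phi>1: "norm (\<phi> \<zeta>) < 1" if "norm \<zeta> < 1" for \<zeta>
    unfolding \<phi>_def using right_half_plane_quotient_bound(2) hpos[OF that] b by blast
  have "(G has_field_derivative deriv G z0) (at (z0 + of_real r * 0))"
    using hol r by (simp add: holomorphic_derivI)
  then have dh: "(h has_field_derivative deriv G z0 * of_real r) (at 0)"
    unfolding h_def by (rule DERIV_chain2) (auto intro!: derivative_eq_intros)
  have nz: "h 0 + cnj b \<noteq> 0" using right_half_plane_quotient_bound(1) hpos b by simp
  have hb: "h 0 = b" by (simp add: h_def b_def)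
  have "(\<phi> has_field_derivative (deriv G z0 * of_real r) / (h 0 + cnj b)) (at 0)"
    unfolding \<phi>_def
    by (rule derivative_eq_intros dh nz refl)+ (use nz in \<open>simp add: hb power2_eq_square\<close>)
  \<comment> \<open>The denominator at the centre is \<open>b + cnj b\<close>, twice the real part
    of \<open>b\<close>.\<close>
  then have "deriv \<phi> 0 = (deriv G z0 * of_real r) / of_real (2 * Re b)"
    by (metis DERIV_imp_deriv complex_add_cnj hb)
  moreover have "norm (deriv \<phi> 0) \<le> 1"
    by (rule Schwarz_Lemma(2)[OF hol\<phi> \<phi>0 \<phi>1, of 0]) auto
  ultimately show "norm (deriv G z0) \<le> 2 * Re (G z0) / r"
    using b r by (simp add: norm_divide norm_mult field_simps b_def)
  assume z: "z \<in> ball z0 r"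
  define \<zeta> where "\<zeta> = (z - z0) / of_real r"
  have n\<zeta>: "norm \<zeta> = dist z0 z / r"
    using r by (simp add: \<zeta>_def norm_divide dist_norm norm_minus_commute)
  have \<zeta>1: "norm \<zeta> < 1" using z r by (simp add: n\<zeta>)
  have hz: "h \<zeta> = G z" using r by (simp add: h_def \<zeta>_def)
  have "norm ((h \<zeta> - b) / (h \<zeta> + cnj b)) \<le> norm \<zeta>"
    using Schwarz_Lemma(1)[OF hol\<phi> \<phi>0 \<phi>1 \<zeta>1] by (simp add: \<phi>_def)
  then have "Re b * (1 - norm \<zeta>) \<le> Re (h \<zeta>) * (1 + norm \<zeta>)"
    using right_half_plane_quotient_bound(3)[OF hpos[OF \<zeta>1] b] \<zeta>1 by simp
  then have "Re b * (1 - norm \<zeta>) * r \<le> Re (h \<zeta>) * (1 + norm \<zeta>) * r"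
    using r by (simp add: mult_right_mono)
  then show "Re (G z0) * (r - dist z0 z) \<le> Re (G z) * (r + dist z0 z)"
    using r unfolding n\<zeta> hz b_def by (simp add: algebra_simps)
qed

text \<open>By connectedness the real part has one sign on the ball, so the previous estimate
  applies to \<open>G\<close> or to \<open>- G\<close>.\<close>

lemma nonvanishing_real_part_gradient:
  assumes hol: "G holomorphic_on ball z0 r" and r: "r > 0"
    and nz: "\<And>z. z \<in> ball z0 r \<Longrightarrow> Re (G z) \<noteq> 0"
  shows "norm (deriv G z0) \<le> 2 * \<bar>Re (G z0)\<bar> / r"
proof -
  have con: "connected ((\<lambda>z. Re (G z)) ` ball z0 r)"
    by (intro connected_continuous_image continuous_intros holomorphic_on_imp_continuous_on hol) auto
  have z0: "z0 \<in> ball z0 r" using r by simp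
  have sgn: "(\<forall>z\<in>ball z0 r. Re (G z) > 0) \<or> (\<forall>z\<in>ball z0 r. Re (G z) < 0)"
  proof (rule ccontr)
    assume "\<not> ?thesis"
    then obtain x y where xy: "x \<in> ball z0 r" "y \<in> ball z0 r" "Re (G x) \<le> 0" "Re (G y) \<ge> 0"
      by (meson not_le)
    have "0 \<in> (\<lambda>z. Re (G z)) ` ball z0 r"
      using connectedD_interval[OF con, of "Re (G x)" "Re (G y)" 0] xy by blast
    then show False using nz by force
  qed
  then show ?thesis
  proof
    assume "\<forall>z\<in>ball z0 r. Re (G z) > 0"
    then show ?thesis
      using positive_real_part_estimates(1)[OF hol r] z0 by fastforce
  next
    assume neg: "\<forall>z\<in>ball z0 r. Re (G z) < 0"
    have "norm (deriv (\<lambda>z. - G z) z0) \<le> 2 * Re (- G z0) / r"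
      using positive_real_part_estimates(1)[of "\<lambda>z. - G z" z0 r] hol r neg
      by (auto intro: holomorphic_intros)
    moreover have "deriv (\<lambda>z. - G z) z0 = - deriv G z0"
      using hol r by (simp add: holomorphic_on_imp_differentiable_at)
    ultimately show ?thesis using neg[rule_format, OF z0] by simp
  qed
qed

text \<open>Hopf's boundary lemma at the zero of \<open>Re G\<close> nearest to \<open>z0\<close>: by Harnack, the real part
  has slope at least \<open>Re (G z0) / (2 r)\<close> there.\<close>

lemma real_part_bound_by_distance_to_zero_aux:
  assumes hol: "G holomorphic_on S" and S: "open S" and sub: "cball z0 (dist z0 p) \<subseteq> S"
    and p: "Re (G p) = 0" and pos: "Re (G z0) > 0"
    and C: "\<And>z. z \<in> S \<Longrightarrow> Re (G z) = 0 \<Longrightarrow> norm (deriv G z) \<le> C"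
  shows "Re (G z0) \<le> 2 * C * dist z0 p"
proof -
  \<comment> \<open>Compactness of this zero set yields a zero \<open>q\<close> nearest to
    \<open>z0\<close>. The open ball around \<open>z0\<close> reaching up to \<open>q\<close> is
    free of zeros, so Harnack's inequality is available on it.\<close>
  define Z where "Z = {z \<in> cball z0 (dist z0 p). Re (G z) = 0}"
  have contG: "continuous_on (cball z0 (dist z0 p)) (\<lambda>z. Re (G z))"
    by (intro continuous_intros holomorphic_on_imp_continuous_on holomorphic_on_subset[OF hol sub])
  have "closed Z"
    unfolding Z_def using continuous_closed_preimage_constant[OF contG closed_cball, of 0] by simp
  moreover have "Z \<subseteq> cball z0 (dist z0 p)" by (auto simp: Z_def)
  ultimately have "closed Z" "bounded Z" using bounded_subset[OF bounded_cball] by auto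
  moreover have "p \<in> Z" by (simp add: Z_def p)
  ultimately obtain q where q: "q \<in> Z" and qmin: "\<And>y. y \<in> Z \<Longrightarrow> dist z0 q \<le> dist z0 y"
    using distance_attains_inf[of Z z0] by blast
  define r where "r = dist z0 q"
  have rp: "r \<le> dist z0 p" using qmin \<open>p \<in> Z\<close> by (simp add: r_def)
  have Gq: "Re (G q) = 0" using q by (simp add: Z_def)
  have r: "r > 0" using pos Gq by (auto simp: r_def)
  have qS: "q \<in> S" using q sub by (auto simp: Z_def)
  have bsub: "ball z0 r \<subseteq> S" "ball z0 r \<subseteq> cball z0 (dist z0 p)" using sub rp by auto
  have nz: "Re (G z) \<noteq> 0" if "z \<in> ball z0 r" for z
    using qmin[of z] that rp by (force simp: Z_def r_def)
  have con: "connected ((\<lambda>z. Re (G z)) ` ball z0 r)"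
    using bsub contG by (intro connected_continuous_image continuous_on_subset[OF contG]) auto
  have posb: "Re (G z) > 0" if z: "z \<in> ball z0 r" for z
  proof (rule ccontr)
    assume "\<not> ?thesis"
    then have "0 \<in> (\<lambda>z. Re (G z)) ` ball z0 r"
      using connectedD_interval[OF con, of "Re (G z)" "Re (G z0)" 0] z r pos by auto
    then show False using nz by force
  qed
  \<comment> \<open>The segment from the centre to the boundary zero \<open>q\<close>; only
    difference quotients from the left at \<open>t = 1\<close> stay inside the ball.\<close>
  define \<gamma> where "\<gamma> = (\<lambda>t. z0 + of_real t * (q - z0))"
  define \<psi> where "\<psi> = (\<lambda>t. Re (G (\<gamma> t)))"
  have "(G has_field_derivative deriv G q) (at (\<gamma> 1))"
    using hol S qS by (simp add: holomorphic_derivI \<gamma>_def)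
  moreover have "(\<gamma> has_vector_derivative (q - z0)) (at 1)"
    unfolding \<gamma>_def by (auto intro!: derivative_eq_intros)
  ultimately have "((G \<circ> \<gamma>) has_vector_derivative (q - z0) * deriv G q) (at 1)"
    by (intro field_vector_diff_chain_at) auto
  then have "(\<psi> has_real_derivative Re ((q - z0) * deriv G q)) (at 1)"
    by (simp add: \<psi>_def has_vector_derivative_complex_iff o_def)
  then have lim: "((\<lambda>t. (\<psi> t - \<psi> 1) / (t - 1)) \<longlongrightarrow> Re ((q - z0) * deriv G q)) (at_left 1)"
    unfolding has_field_derivative_iff by (rule filterlim_mono[OF _ order_refl at_le]) auto
  have lim2: "((\<lambda>t::real. - Re (G z0) / (1 + t)) \<longlongrightarrow> - Re (G z0) / (1 + 1)) (at_left 1)"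
    by (intro tendsto_intros) auto
  \<comment> \<open>Harnack gives \<open>\<psi> t \<ge> Re (G z0) * (1 - t) / (1 + t)\<close>, while
    \<open>\<psi> 1 = 0\<close>. Dividing by the negative number \<open>t - 1\<close> reverses the
    inequality, and \<open>t \<rightarrow> 1\<close> then bounds the slope at \<open>q\<close> away
    from zero.\<close>
  have ev: "\<forall>\<^sub>F t in at_left 1. (\<psi> t - \<psi> 1) / (t - 1) \<le> - Re (G z0) / (1 + t)"
    using eventually_at_left_real[OF zero_less_one]
  proof eventually_elim
    case (elim t)
    then have t: "0 < t" "t < 1" by auto
    have d: "dist z0 (\<gamma> t) = t * r"
      using t by (simp add: \<gamma>_def dist_norm norm_mult r_def norm_minus_commute)
    then have "\<gamma> t \<in> ball z0 r" using t r by simp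
    then have "Re (G z0) * (r - t * r) \<le> \<psi> t * (r + t * r)"
      using positive_real_part_estimates(2)[OF holomorphic_on_subset[OF hol bsub(1)] r posb, of "\<gamma> t"] d
      by (simp add: \<psi>_def)
    then have "(Re (G z0) * (1 - t)) * r \<le> (\<psi> t * (1 + t)) * r"
      by (simp add: algebra_simps)
    then have "Re (G z0) * (1 - t) \<le> \<psi> t * (1 + t)"
      using r by simp
    moreover have "\<psi> 1 = 0" by (simp add: \<psi>_def \<gamma>_def Gq)
    ultimately show ?case using t by (simp add: field_simps)
  qed
  have "Re ((q - z0) * deriv G q) \<le> - Re (G z0) / (1 + 1)"
    by (rule tendsto_le[OF _ lim2 lim ev]) simp
  moreover have "\<bar>Re ((q - z0) * deriv G q)\<bar> \<le> r * norm (deriv G q)"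
    using abs_Re_le_cmod[of "(q - z0) * deriv G q"] by (simp add: norm_mult r_def dist_norm norm_minus_commute)
  ultimately have "Re (G z0) \<le> 2 * (r * norm (deriv G q))" by simp
  also have "\<dots> \<le> 2 * (dist z0 p * C)"
    using C[OF qS Gq] rp r by (intro mult_left_mono mult_mono) auto
  finally show ?thesis by (simp add: algebra_simps)
qed

lemma real_part_bound_by_distance_to_zero:
  assumes hol: "G holomorphic_on S" and S: "open S" and sub: "cball z0 (dist z0 p) \<subseteq> S"
    and p: "Re (G p) = 0"
    and C: "\<And>z. z \<in> S \<Longrightarrow> Re (G z) = 0 \<Longrightarrow> norm (deriv G z) \<le> C"
  shows "\<bar>Re (G z0)\<bar> \<le> 2 * C * dist z0 p"
proof -
  have pS: "p \<in> S" using sub by auto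
  have C0: "C \<ge> 0" using C[OF pS p] norm_ge_zero order_trans by blast
  consider "Re (G z0) > 0" | "Re (G z0) = 0" | "Re (G z0) < 0" by linarith
  then show ?thesis
  proof cases
    case 1
    then show ?thesis using real_part_bound_by_distance_to_zero_aux[OF hol S sub p] C by simp
  next
    case 2
    then show ?thesis using C0 by simp
  next
    case 3
    have "deriv (\<lambda>z. - G z) z = - deriv G z" if "z \<in> S" for z
      using hol S that by (simp add: holomorphic_on_imp_differentiable_at)
    then have "Re (- G z0) \<le> 2 * C * dist z0 p"
      using 3 C p hol
      by (intro real_part_bound_by_distance_to_zero_aux[OF _ S sub]) (auto intro: holomorphic_intros)
    then show ?thesis using 3 by simp
  qed
qed

section \<open>The derivative bound\<close>

text \<open>The strictness is what later contradicts \<open>|G'(0)| = 2 cosh (Re (G 0))\<close>. It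
  comes from \<open>2 cosh x > exp |x| \<ge> 1 + |x| + x^2/2\<close> together with
  \<open>(|x| - 1)^2 \<ge> 0\<close>.\<close>

lemma abs_less_cosh: "\<bar>x\<bar> < cosh (x::real)"
proof -
  have "1 + \<bar>x\<bar> + \<bar>x\<bar>\<^sup>2 / 2 \<le> exp \<bar>x\<bar>"
    by (rule exp_lower_Taylor_quadratic) simp
  moreover have "2 * cosh \<bar>x\<bar> > exp \<bar>x\<bar>"
    by (simp add: cosh_field_def)
  moreover have "(\<bar>x\<bar> - 1)\<^sup>2 \<ge> 0" by simp
  ultimately have "\<bar>x\<bar> < cosh \<bar>x\<bar>"
    unfolding power2_diff by simp
  then show ?thesis by simp
qed

text \<open>The constants form a chain: \<open>|Re G| \<le> 8 (|z| + 1)\<close>, hence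
  \<open>|G'| \<le> 48\<close>, hence \<open>|G''| \<le> 1/12\<close> on the disc of radius 12.
  There \<open>G'\<close> differs from \<open>G'(0)\<close> by at most 1, so it has no zero, and
  \<open>G\<close> covers the disc of radius 12 about \<open>G 0\<close>, which contains a point of
  \<open>2 \<pi> \<i> \<int>\<close>.\<close>

lemma ramified_logarithm_contradiction:
  fixes G :: "complex \<Rightarrow> complex"
  assumes hol: "G holomorphic_on ball 0 R" and R: "R \<ge> 3000"
    and bnd: "\<And>z. z \<in> ball 0 R \<Longrightarrow> norm (deriv G z) \<le> 4 * cosh (Re (G z))"
    and d0: "norm (deriv G 0) = 2 * cosh (Re (G 0))"
  obtains w where "w \<in> ball 0 R" "exp (G w) = 1" "deriv G w \<noteq> 0"
proof -
  have subR: "S \<subseteq> ball 0 R \<Longrightarrow> G holomorphic_on S" for S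
    using hol holomorphic_on_subset by blast
  \<comment> \<open>Were \<open>Re G\<close> free of zeros on the unit disc, the gradient estimate
    would give \<open>|G'(0)| \<le> 2 |Re (G 0)|\<close>, which is less than
    \<open>2 cosh (Re (G 0))\<close>.\<close>
  obtain p where p: "norm p < 1" "Re (G p) = 0"
  proof (rule ccontr)
    assume "\<not> thesis"
    then have "norm (deriv G 0) \<le> 2 * \<bar>Re (G 0)\<bar> / 1"
      using that R by (intro nonvanishing_real_part_gradient subR) auto
    then show False using d0 abs_less_cosh[of "Re (G 0)"] by simp
  qed
  \<comment> \<open>On the zero set of \<open>Re G\<close> the bound on \<open>G'\<close> reads
    \<open>4 cosh 0 = 4\<close>. The premise on \<open>z\<close> keeps the closed ball around
    \<open>z\<close> through \<open>p\<close> inside the domain.\<close>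
  have u: "\<bar>Re (G z)\<bar> \<le> 8 * (norm z + 1)" if z: "2 * norm z + 1 < R" for z
  proof -
    have d: "dist z p \<le> norm z + 1"
      using p(1) norm_triangle_ineq4[of z p] by (simp add: dist_norm)
    have "cball z (dist z p) \<subseteq> ball 0 R"
    proof
      fix x assume "x \<in> cball z (dist z p)"
      then have "dist z x \<le> norm z + 1" using d by simp
      moreover have "norm x \<le> norm z + dist z x"
        by (metis dist_norm norm_minus_commute norm_triangle_sub)
      ultimately show "x \<in> ball 0 R" using z by simp
    qed
    then have "\<bar>Re (G z)\<bar> \<le> 2 * 4 * dist z p"
      using bnd by (intro real_part_bound_by_distance_to_zero[OF hol open_ball _ p(2)]) fastforce+
    then show ?thesis using d by simp
  qed
  \<comment> \<open>On the ball of radius \<open>norm z + 1\<close> around \<open>z\<close> the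
    previous bound stays below \<open>A\<close>, so \<open>A - G\<close> has positive real part
    there, at most \<open>(16 + 8) (norm z + 1)\<close> at the centre. The premise is that of the
    previous bound at radius \<open>2 * norm z + 1\<close>.\<close>
  have G48: "norm (deriv G z) \<le> 48" if z: "4 * norm z + 3 < R" for z
  proof -
    define A where "A = 16 * (norm z + 1)"
    define H where "H = (\<lambda>w. of_real A - G w)"
    have x: "norm x < 2 * norm z + 1" if "x \<in> ball z (norm z + 1)" for x
      using that norm_triangle_sub[of x z] by (simp add: dist_norm norm_minus_commute)
    have sub: "ball z (norm z + 1) \<subseteq> ball 0 R"
    proof
      fix y assume "y \<in> ball z (norm z + 1)"
      then show "y \<in> ball 0 R" using x[of y] z norm_ge_zero[of z] unfolding mem_ball_0 by linarith
    qed
    have "Re (H w) > 0" if "w \<in> ball z (norm z + 1)" for w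
      using u[of w] x[OF that] z by (simp add: H_def A_def)
    moreover have "H holomorphic_on ball z (norm z + 1)"
      unfolding H_def by (intro holomorphic_intros subR sub)
    ultimately have "norm (deriv H z) \<le> 2 * Re (H z) / (norm z + 1)"
      by (intro positive_real_part_estimates(1)) (auto simp: add_nonneg_pos)
    moreover have "deriv H z = - deriv G z"
    proof -
      have "z \<in> ball 0 R" using z norm_ge_zero[of z] unfolding mem_ball_0 by linarith
      then show ?thesis
        unfolding H_def using hol by (subst deriv_diff) (auto simp: holomorphic_on_imp_differentiable_at)
    qed
    moreover have "Re (H z) \<le> 24 * (norm z + 1)"
    proof -
      have "2 * norm z + 1 < R" using z norm_ge_zero[of z] by linarith
      then show ?thesis using u[of z] unfolding H_def A_def by (simp add: abs_le_iff)
    qed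
    moreover have n: "norm z + 1 > 0" by (simp add: add_nonneg_pos)
    ultimately have "norm (deriv G z) \<le> 2 * Re (H z) / (norm z + 1)" "Re (H z) \<le> 24 * (norm z + 1)"
      by simp_all
    then have "norm (deriv G z) * (norm z + 1) \<le> 48 * (norm z + 1)"
      unfolding pos_le_divide_eq[OF n] by linarith
    then show ?thesis by (rule mult_right_le_imp_le[OF _ n])
  qed
  have holG': "deriv G holomorphic_on ball 0 R" using hol by (simp add: holomorphic_deriv)
  \<comment> \<open>Cauchy's estimate on radius 600 with the strict bound 49 for \<open>G'\<close>,
    and \<open>49/600 \<le> 1/12\<close>. Points this far out have modulus at most 620, and
    \<open>4 * 620 + 3 < 3000\<close> explains the size of \<open>R\<close>.\<close>
  have G2: "norm (deriv (deriv G) z) \<le> 1 / 12" if z: "norm z \<le> 12" for z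
  proof -
    have s: "norm w \<le> 620" if "w \<in> cball z 600" for w
      using that z norm_triangle_sub[of w z] by (simp add: dist_norm norm_minus_commute)
    have sub: "cball z 600 \<subseteq> ball 0 R" using s R by fastforce
    have "norm ((deriv ^^ 1) (deriv G) z) \<le> fact 1 * 49 / 600 ^ 1"
    proof (rule Cauchy_higher_deriv_bound)
      show "deriv G holomorphic_on ball z 600"
        using holG' sub by (meson ball_subset_cball holomorphic_on_subset subset_trans)
      show "continuous_on (cball z 600) (deriv G)"
        using holG' sub by (meson holomorphic_on_imp_continuous_on holomorphic_on_subset)
      show "deriv G w \<in> ball 0 49" if "w \<in> ball z 600" for w
        using G48[of w] s[of w] that R by simp
    qed auto
    then show ?thesis by simp
  qed
  have G'close: "norm (deriv G z - deriv G 0) \<le> 1" if z: "norm z \<le> 12" for z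
  proof -
    have "norm (deriv G z - deriv G 0) \<le> (1/12) * norm (z - 0)"
    proof (rule field_differentiable_bound)
      show "(deriv G has_field_derivative deriv (deriv G) w) (at w within cball 0 12)"
        if "w \<in> cball 0 12" for w
        by (rule has_field_derivative_at_within, rule holomorphic_derivI[OF holG']) (use that R in auto)
    qed (use z G2 in auto)
    then show ?thesis using z by simp
  qed
  have a: "norm (deriv G 0) \<ge> 2" using d0 cosh_real_ge_1[of "Re (G 0)"] by simp
  have dnz: "deriv G z \<noteq> 0" if z: "norm z \<le> 12" for z
    using G'close[OF z] a by auto
  \<comment> \<open>On the circle of radius 12 the linear part has modulus at least
    \<open>2 * 12\<close>, and the deviation from it is at most \<open>1 * 12\<close>.\<close>
  have lower: "norm (G z - G 0) \<ge> 12" if z: "norm z = 12" for z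
  proof -
    define H where "H = (\<lambda>w. G w - deriv G 0 * w)"
    have "norm (H z - H 0) \<le> 1 * norm (z - 0)"
    proof (rule field_differentiable_bound)
      show "(H has_field_derivative deriv G w - deriv G 0) (at w within cball 0 12)"
        if "w \<in> cball 0 12" for w
      proof -
        have "(G has_field_derivative deriv G w) (at w)"
          by (rule holomorphic_derivI[OF hol]) (use that R in auto)
        then have "(H has_field_derivative deriv G w - deriv G 0) (at w)"
          unfolding H_def by (auto intro!: derivative_eq_intros)
        then show ?thesis by (rule has_field_derivative_at_within)
      qed
    qed (use z G'close in auto)
    then have "norm (G z - G 0 - deriv G 0 * z) \<le> 12" using z by (simp add: H_def algebra_simps)
    moreover have "norm (deriv G 0 * z) \<ge> 24" using a z by (simp add: norm_mult)
    ultimately show ?thesis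
      using norm_triangle_ineq4[of "G z - G 0" "G z - G 0 - deriv G 0 * z"] by simp
  qed
  \<comment> \<open>An open map whose boundary values stay at distance 12 from the image of the
    centre covers the disc of that radius.\<close>
  have "ball (G 0) 12 \<subseteq> G ` cball 0 12"
  proof (rule ball_subset_open_map_image)
    have sub: "cball 0 12 \<subseteq> ball 0 R" using R by auto
    show "continuous_on (closure (cball 0 12)) G"
      using subR[OF sub] by (simp add: holomorphic_on_imp_continuous_on)
    have "\<not> G constant_on ball 0 12"
    proof
      assume "G constant_on ball 0 12"
      then obtain c where c: "\<And>x. x \<in> ball 0 12 \<Longrightarrow> G x = c" by (auto simp: constant_on_def)
      have "deriv G 0 = deriv (\<lambda>_. c) 0"
        by (rule deriv_cong_ev)
           (use c in \<open>auto intro!: eventually_nhds_in_open[THEN eventually_mono, of "ball 0 12"]\<close>)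
      then show False using dnz[of 0] by simp
    qed
    moreover have "G holomorphic_on ball 0 12"
      using subR sub ball_subset_cball by blast
    ultimately show "open (G ` interior (cball 0 12))"
      by (simp add: open_mapping_thm2[of G "ball 0 12"] open_mapping_thm[of G "ball 0 12" "ball 0 12"])
    show "norm (G z - G 0) \<ge> 12" if "z \<in> frontier (cball 0 12)" for z
      using lower that by simp
  qed auto
  \<comment> \<open>Rounding \<open>Im (G 0) / (2 * pi)\<close> leaves an imaginary part of at most
    \<pi>. The real part is at most 8 by the growth bound at \<open>0\<close>, and
    \<open>8 + \<pi> < 12\<close>.\<close>
  moreover obtain k :: int where k: "norm (2 * of_int k * of_real pi * \<i> - G 0) < 12"
  proof
    define y where "y = Im (G 0) / (2 * pi)"
    have "\<bar>y - of_int (round y)\<bar> \<le> 1/2" using of_int_round_abs_le[of y] by linarith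
    then have "\<bar>2 * pi * y - 2 * pi * of_int (round y)\<bar> \<le> pi"
      by (simp add: abs_mult flip: right_diff_distrib)
    then have "\<bar>Im (2 * of_int (round y) * of_real pi * \<i> - G 0)\<bar> \<le> pi"
      by (simp add: y_def algebra_simps abs_minus_commute)
    moreover have "\<bar>Re (2 * of_int (round y) * of_real pi * \<i> - G 0)\<bar> \<le> 8"
      using u[of 0] R by simp
    ultimately show "norm (2 * of_int (round y) * of_real pi * \<i> - G 0) < 12"
      using cmod_le[of "2 * of_int (round y) * of_real pi * \<i> - G 0"] pi_less_4 by linarith
  qed
  ultimately have "2 * of_int k * of_real pi * \<i> \<in> G ` cball 0 12"
    by (auto simp: dist_norm norm_minus_commute subset_iff simp del: mem_cball_0)
  then obtain w where w: "norm w \<le> 12" "G w = 2 * of_int k * of_real pi * \<i>"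
    by auto
  have "exp (G w) = 1" unfolding w(2) exp_eq_1 by (auto intro!: exI[of _ k])
  then show thesis using that[of w] w(1) dnz R by auto
qed

text \<open>Zalcman's rescaling at a maximum point of \<open>(1/2 - |z|) |G'(z)| / cosh (Re (G z))\<close>
  reduces the estimate to the previous lemma.\<close>

proposition ramified_logarithm_bound:
  assumes hol: "G holomorphic_on ball 0 1"
    and ram: "\<And>z. z \<in> ball 0 1 \<Longrightarrow> exp (G z) = 1 \<Longrightarrow> deriv G z = 0"
  shows "norm (deriv G 0) \<le> 24000 * cosh (Re (G 0))"
proof (rule ccontr)
  assume contra: "\<not> ?thesis"
  \<comment> \<open>Half the quotient in question, so that rescaling to \<open>N = 1\<close>
    produces the normalisation \<open>|G'| = 2 cosh (Re G)\<close>.\<close>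
  define N where "N = (\<lambda>z. norm (deriv G z) / (2 * cosh (Re (G z))))"
  have N0: "N 0 > 12000"
    using contra by (simp add: N_def divide_simps)
  have sub: "cball 0 (1/2) \<subseteq> ball (0::complex) 1" by auto
  have "continuous_on (ball 0 1) G" "continuous_on (ball 0 1) (deriv G)"
    using hol by (auto intro: holomorphic_on_imp_continuous_on holomorphic_deriv)
  then have "continuous_on (cball 0 (1/2)) G" "continuous_on (cball 0 (1/2)) (deriv G)"
    using sub by (auto intro: continuous_on_subset)
  then have "continuous_on (cball 0 (1/2)) (\<lambda>z. (1/2 - norm z) * N z)"
    unfolding N_def by (intro continuous_intros) (auto simp: continuous_intros)
  then obtain z1 where z1: "norm z1 \<le> 1/2"
    and max: "\<And>z. norm z \<le> 1/2 \<Longrightarrow> (1/2 - norm z) * N z \<le> (1/2 - norm z1) * N z1"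
    using continuous_attains_sup[of "cball 0 (1/2)" "\<lambda>z. (1/2 - norm z) * N z"] by force
  define m where "m = (1/2 - norm z1) * N z1"
  \<comment> \<open>The maximum is at least the value at \<open>0\<close>, which is
    \<open>N 0 / 2\<close>.\<close>
  have m: "m > 6000" using max[of 0] N0 by (simp add: m_def)
  have N1: "N z1 > 0"
    using m z1 unfolding m_def by (metis diff_ge_0_iff_ge less_trans mult_nonneg_nonpos not_less zero_less_numeral)
  \<comment> \<open>Zalcman's scale. Since \<open>s * m\<close> is the distance from
    \<open>z1\<close> to the circle of radius \<open>1/2\<close> and \<open>m > 6000\<close>, the
    rescaled disc of radius 3000 uses up at most half of that distance.\<close>
  define s where "s = 1 / N z1"
  have s: "s > 0" using N1 by (simp add: s_def)
  have sm: "s * m = 1/2 - norm z1" using N1 by (simp add: s_def m_def)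
  have s3: "s * 3000 \<le> (1/2 - norm z1) / 2"
    using mult_left_mono[of 6000 m s] m s sm by simp
  define \<gamma> where "\<gamma> = (\<lambda>\<zeta>. z1 + of_real s * \<zeta>)"
  have n\<gamma>: "1/2 - norm (\<gamma> \<zeta>) \<ge> (1/2 - norm z1) / 2" if "norm \<zeta> < 3000" for \<zeta>
  proof -
    have "norm (\<gamma> \<zeta>) \<le> norm z1 + s * norm \<zeta>"
      unfolding \<gamma>_def using norm_triangle_ineq[of z1 "of_real s * \<zeta>"] s by (simp add: norm_mult)
    moreover have "s * norm \<zeta> \<le> s * 3000" using s that by simp
    ultimately show ?thesis using s3 by simp
  qed
  have pos1: "1/2 - norm z1 > 0" using sm s m by (metis less_trans mult_pos_pos zero_less_numeral)
  have \<gamma>1: "norm (\<gamma> \<zeta>) \<le> 1/2" if "norm \<zeta> < 3000" for \<zeta>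
    using n\<gamma>[OF that] pos1 by (simp add: field_simps)
  then have \<gamma>b: "\<gamma> \<zeta> \<in> ball 0 1" if "norm \<zeta> < 3000" for \<zeta> using that by fastforce
  define H where "H = (\<lambda>\<zeta>. G (\<gamma> \<zeta>))"
  have holH: "H holomorphic_on ball 0 3000"
    unfolding H_def
    by (rule holomorphic_on_compose_gen[OF _ hol, unfolded o_def])
       (use \<gamma>b in \<open>auto intro!: holomorphic_intros simp: \<gamma>_def\<close>)
  have dH: "deriv H \<zeta> = deriv G (\<gamma> \<zeta>) * of_real s" if "norm \<zeta> < 3000" for \<zeta>
  proof (rule DERIV_imp_deriv)
    have "(G has_field_derivative deriv G (\<gamma> \<zeta>)) (at (\<gamma> \<zeta>))"
      using hol \<gamma>b[OF that] by (simp add: holomorphic_derivI)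
    then show "(H has_field_derivative deriv G (\<gamma> \<zeta>) * of_real s) (at \<zeta>)"
      unfolding H_def by (rule DERIV_chain2) (auto intro!: derivative_eq_intros simp: \<gamma>_def)
  qed
  have NG: "norm (deriv G z) = N z * (2 * cosh (Re (G z)))" for z
    by (simp add: N_def)
  obtain w where w: "w \<in> ball 0 3000" "exp (H w) = 1" "deriv H w \<noteq> 0"
  proof (rule ramified_logarithm_contradiction[OF holH order_refl])
    fix \<zeta> :: complex assume "\<zeta> \<in> ball 0 3000"
    then have \<zeta>: "norm \<zeta> < 3000" by simp
    define c where "c = 1/2 - norm z1"
    have c: "c > 0" using pos1 by (simp add: c_def)
    \<comment> \<open>The weight has lost at most half of its value at \<open>z1\<close>, so by
      maximality \<open>N\<close> is at most twice \<open>N z1\<close>; hence the factor 4 instead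
      of 2.\<close>
    have "c / 2 * N (\<gamma> \<zeta>) \<le> (1/2 - norm (\<gamma> \<zeta>)) * N (\<gamma> \<zeta>)"
      using n\<gamma>[OF \<zeta>] by (intro mult_right_mono) (auto simp: N_def c_def)
    also have "\<dots> \<le> c * N z1" using max[OF \<gamma>1[OF \<zeta>]] by (simp add: c_def)
    finally have "N (\<gamma> \<zeta>) \<le> 2 * N z1" using c by (simp add: field_simps)
    then have "s * N (\<gamma> \<zeta>) \<le> 2" using N1 by (simp add: s_def field_simps)
    then have "s * N (\<gamma> \<zeta>) * (2 * cosh (Re (G (\<gamma> \<zeta>)))) \<le> 2 * (2 * cosh (Re (G (\<gamma> \<zeta>))))"
      by (intro mult_right_mono) auto
    then show "norm (deriv H \<zeta>) \<le> 4 * cosh (Re (H \<zeta>))"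
      unfolding dH[OF \<zeta>] norm_mult NG using s by (simp add: H_def mult_ac)
  next
    show "norm (deriv H 0) = 2 * cosh (Re (H 0))"
      using s N1 by (simp add: dH norm_mult NG) (simp add: H_def s_def \<gamma>_def)
  qed
  then show False using ram[of "\<gamma> w"] \<gamma>b[of w] dH[of w] by (simp add: H_def)
qed

section \<open>The Riemann sphere\<close>

text \<open>Stereographic projection onto the unit sphere, infinity being the north pole. Through
  it, spherical convergence becomes convergence in a complete normed space.\<close>

definition stereo :: "complex option \<Rightarrow> complex \<times> real" where
  "stereo p = (case p of None \<Rightarrow> (0, 1)
    | Some z \<Rightarrow> ((2 / (1 + (norm z)\<^sup>2)) *\<^sub>R z, ((norm z)\<^sup>2 - 1) / (1 + (norm z)\<^sup>2)))"

definition hom :: "complex option \<Rightarrow> complex \<times> complex" where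
  "hom p = (case p of None \<Rightarrow> (1, 0) | Some z \<Rightarrow> (z, 1))"

text \<open>It vanishes exactly when two nonzero coordinate pairs represent the same point.
  Homogeneous coordinates avoid separate formulas at infinity.\<close>

definition det2 :: "complex \<times> complex \<Rightarrow> complex \<times> complex \<Rightarrow> complex" where
  "det2 p q = fst p * snd q - snd p * fst q"

lemma one_plus_norm_sq_pos [simp]: "1 + (norm (z::complex))\<^sup>2 > 0" "1 + (norm z)\<^sup>2 \<noteq> 0"
proof -
  show "1 + (norm z)\<^sup>2 > 0" by (simp add: add_pos_nonneg)
  then show "1 + (norm z)\<^sup>2 \<noteq> 0" by simp
qed

lemma norm_Pair_power2: "(norm (a, b))\<^sup>2 = (norm a)\<^sup>2 + (norm b)\<^sup>2"
  by (simp add: norm_Pair)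

lemma norm_stereo: "norm (stereo p) = 1"
proof (cases p)
  case (Some z)
  define A where "A = 1 + (norm z)\<^sup>2"
  have A: "A > 0" by (simp add: A_def)
  have n: "(norm z)\<^sup>2 = A - 1" by (simp add: A_def)
  have "(norm (stereo p))\<^sup>2 = 1"
    using A by (simp add: Some stereo_def norm_Pair_power2 n A_def[symmetric] power_mult_distrib power_divide)
      (simp add: divide_simps power2_eq_square algebra_simps)
  then show ?thesis using power2_eq_imp_eq[of "norm (stereo p)" 1] by simp
qed (simp add: stereo_def norm_Pair)

text \<open>Both sides are nonnegative, so it suffices to compare squares. The triangle inequality
  and uniform limit theorems for the chordal metric are inherited this way.\<close>

lemma chordal_eq_dist: "chordal p q = dist (stereo p) (stereo q)"
proof -
  have nn: "chordal p q \<ge> 0" by (cases "(p, q)" rule: chordal.cases) auto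
  have fin_inf: "(norm (stereo (Some z) - stereo None))\<^sup>2 = 4 / (1 + (norm z)\<^sup>2)" for z
  proof -
    define A where "A = 1 + (norm z)\<^sup>2"
    have A: "A > 0" by (simp add: A_def)
    have n: "(norm z)\<^sup>2 = A - 1" by (simp add: A_def)
    show ?thesis
      using A by (simp add: stereo_def norm_Pair_power2 n A_def[symmetric] power_mult_distrib power_divide)
        (simp add: divide_simps power2_eq_square algebra_simps)
  qed
  have fin: "(norm (stereo (Some z) - stereo (Some w)))\<^sup>2
    = 4 * (norm (z - w))\<^sup>2 / ((1 + (norm z)\<^sup>2) * (1 + (norm w)\<^sup>2))" for z w
  proof -
    define A B where "A = 1 + (norm z)\<^sup>2" and "B = 1 + (norm w)\<^sup>2"
    have A: "A > 0" "B > 0" by (auto simp: A_def B_def)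
    have n: "(norm z)\<^sup>2 = A - 1" "(norm w)\<^sup>2 = B - 1" by (auto simp: A_def B_def)
    have ip: "(norm (x - y))\<^sup>2 = (norm x)\<^sup>2 + (norm y)\<^sup>2 - 2 * (x \<bullet> y)" for x y :: complex
      by (simp add: power2_norm_eq_inner inner_diff inner_commute)
    show ?thesis
      using A by (simp add: stereo_def norm_Pair_power2 ip n A_def[symmetric] B_def[symmetric] power_mult_distrib power_divide)
        (simp add: divide_simps power2_eq_square algebra_simps)
  qed
  have "(chordal p q)\<^sup>2 = (norm (stereo p - stereo q))\<^sup>2"
    using fin fin_inf norm_minus_commute[of "stereo None"]
    by (cases "(p, q)" rule: chordal.cases) (auto simp: power_divide power_mult_distrib)
  then show ?thesis using nn by (simp add: dist_norm)
qed

lemma stereo_inject: "stereo p = stereo q \<longleftrightarrow> p = q"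
proof
  assume "stereo p = stereo q"
  then have "chordal p q = 0" by (simp add: chordal_eq_dist)
  then show "p = q" by (cases "(p, q)" rule: chordal.cases) (auto simp: add_nonneg_eq_0_iff)
qed simp

text \<open>Inverse projection from the north pole, \<open>(c, s) \<mapsto> c / (1 - s)\<close>. It
  turns limits on the sphere back into points of the extended plane.\<close>

lemma stereo_surj:
  assumes "norm x = 1"
  obtains p where "stereo p = x"
proof (cases "snd x = 1")
  case True
  then have "fst x = 0" using assms by (simp add: norm_prod_def)
  then show thesis using True that[of None] by (simp add: stereo_def prod_eq_iff)
next
  case False
  obtain c s where x: "x = (c, s)" by (cases x)
  have cs: "(norm c)\<^sup>2 = 1 - s\<^sup>2" using assms by (simp add: x norm_Pair)
  have s: "s \<noteq> 1" using False x by simp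
  have "(norm (c / of_real (1 - s)))\<^sup>2 = (1 - s\<^sup>2) / (1 - s)\<^sup>2"
    unfolding norm_divide power_divide cs norm_of_real power2_abs ..
  also have "1 - s\<^sup>2 = (1 + s) * (1 - s)" by (simp add: power2_eq_square algebra_simps)
  also have "(1 + s) * (1 - s) / (1 - s)\<^sup>2 = (1 + s) / (1 - s)"
    using s by (simp add: power2_eq_square)
  finally have "(norm (c / of_real (1 - s)))\<^sup>2 = (1 + s) / (1 - s)" .
  moreover have "1 + (1 + s) / (1 - s) = 2 / (1 - s)" "(1 + s) / (1 - s) - 1 = 2 * s / (1 - s)"
    using s by (auto simp: divide_simps)
  ultimately have "stereo (Some (c / of_real (1 - s))) = x"
    using s by (simp add: stereo_def x scaleR_conv_of_real)
  then show thesis by (rule that)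
qed

text \<open>The premises say that \<open>x\<close> and \<open>y\<close> are homogeneous coordinates of \<open>p\<close> and \<open>q\<close>.\<close>

lemma chordal_hom:
  assumes x: "fst x * snd (hom p) = snd x * fst (hom p)" and x0: "x \<noteq> 0"
    and y: "fst y * snd (hom q) = snd y * fst (hom q)" and y0: "y \<noteq> 0"
  shows "chordal p q = 2 * norm (det2 x y) / (norm x * norm y)"
proof -
  \<comment> \<open>Coordinates of \<open>p\<close> are multiples of \<open>hom p\<close>, and the
    claimed quotient is invariant under scaling by nonzero factors.\<close>
  have *: "\<exists>c. x = (c * fst (hom p), c * snd (hom p))"
    if "fst x * snd (hom p) = snd x * fst (hom p)" for x p
    using that by (cases p) (auto simp: hom_def prod_eq_iff)
  obtain c d where cd: "x = (c * fst (hom p), c * snd (hom p))" "y = (d * fst (hom q), d * snd (hom q))"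
    using *[OF x] *[OF y] by blast
  then have cd0: "c \<noteq> 0" "d \<noteq> 0" using x0 y0 by (auto simp: prod_eq_iff)
  have n: "norm (e * u, e * v) = norm e * norm (u, v)" for e u v :: complex
    by (simp add: norm_Pair norm_mult power_mult_distrib real_sqrt_mult flip: distrib_left)
  have "det2 x y = c * d * det2 (hom p) (hom q)"
    by (simp add: cd det2_def algebra_simps)
  moreover have "chordal p q = 2 * norm (det2 (hom p) (hom q)) / (norm (hom p) * norm (hom q))"
    by (cases "(p, q)" rule: chordal.cases)
       (auto simp: hom_def det2_def norm_Pair norm_minus_commute add.commute)
  ultimately show ?thesis using cd0 by (simp add: cd n norm_mult)
qed

lemma hom_nonzero: "hom p \<noteq> 0" by (cases p) (auto simp: hom_def zero_prod_def)

lemma det2_hom_eq_0_iff: "det2 (hom p) (hom q) = 0 \<longleftrightarrow> p = q"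
  by (cases p; cases q) (auto simp: hom_def det2_def)

lemma norm_det2_le: "norm (det2 x y) \<le> 2 * norm x * norm y"
proof -
  have "norm (fst x * snd y) \<le> norm x * norm y" "norm (snd x * fst y) \<le> norm x * norm y"
    using norm_fst_le[of "fst x" "snd x"] norm_snd_le[of "snd x" "fst x"]
      norm_fst_le[of "fst y" "snd y"] norm_snd_le[of "snd y" "fst y"]
    by (auto simp: norm_mult intro!: mult_mono)
  then show ?thesis
    unfolding det2_def using norm_triangle_ineq4[of "fst x * snd y" "snd x * fst y"] by simp
qed

text \<open>In homogeneous coordinates: the Moebius map sending \<open>a, b, c\<close> to \<open>1, 0, \<infinity>\<close>.\<close>

definition moeb :: "complex option \<Rightarrow> complex option \<Rightarrow> complex option \<Rightarrow> complex \<times> complex \<Rightarrow> complex" where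
  "moeb a b c x = (det2 (hom a) (hom c) * det2 x (hom b)) / (det2 (hom a) (hom b) * det2 x (hom c))"

text \<open>Numerator and denominator are both homogeneous of degree one. This allows evaluation in
  any holomorphic coordinates of a meromorphic function.\<close>

lemma moeb_scale:
  assumes "fst x * snd (hom p) = snd x * fst (hom p)" and "x \<noteq> 0"
  shows "moeb a b c x = moeb a b c (hom p)"
proof -
  have "\<exists>k. x = (k * fst (hom p), k * snd (hom p))"
    using assms(1) by (cases p) (auto simp: hom_def prod_eq_iff)
  then obtain k where k: "x = (k * fst (hom p), k * snd (hom p))" by blast
  have "k \<noteq> 0" using k assms(2) by (auto simp: prod_eq_iff)
  moreover have "det2 x y = k * det2 (hom p) y" for y by (simp add: k det2_def algebra_simps)
  ultimately show ?thesis by (simp add: moeb_def)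
qed

lemma moeb_eq_0_iff:
  assumes "a \<noteq> b" "a \<noteq> c" "p \<noteq> c"
  shows "moeb a b c (hom p) = 0 \<longleftrightarrow> p = b"
  using assms by (simp add: moeb_def det2_hom_eq_0_iff)

text \<open>The Pluecker relation for four vectors in the plane. It shows that
  \<open>moeb a b c\<close> takes the value 1 only at \<open>a\<close>.\<close>

lemma det2_pluecker: "det2 a c * det2 p b - det2 a b * det2 p c = det2 p a * det2 b c"
  by (simp add: det2_def algebra_simps)

lemma moeb_eq_1:
  assumes "distinct [a, b, c]" "p \<noteq> c" "moeb a b c (hom p) = 1"
  shows "p = a"
proof -
  have "det2 (hom a) (hom c) * det2 (hom p) (hom b) = det2 (hom a) (hom b) * det2 (hom p) (hom c)"
    using assms by (auto simp: moeb_def det2_hom_eq_0_iff divide_simps split: if_splits)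
  then have "det2 (hom p) (hom a) * det2 (hom b) (hom c) = 0"
    using det2_pluecker[of "hom a" "hom c" "hom p" "hom b"] by simp
  then show ?thesis using assms(1) by (auto simp: det2_hom_eq_0_iff)
qed

text \<open>In homogeneous coordinates the Moebius map is the linear map \<open>u\<close>. It
  multiplies \<open>det2\<close> by the constant \<open>\<alpha> * \<beta> * \<delta>\<close> and
  norms by at most \<open>C\<close>, so the formula for the chordal distance in coordinates gives
  the Lipschitz constant of the inverse map.\<close>

lemma chordal_le_chordal_moeb:
  assumes "distinct [a, b, c]"
  obtains L where "L > 0" and "\<And>p q. p \<noteq> c \<Longrightarrow> q \<noteq> c \<Longrightarrow>
    chordal p q \<le> L * chordal (Some (moeb a b c (hom p))) (Some (moeb a b c (hom q)))"
proof -
  define \<alpha> where "\<alpha> = det2 (hom a) (hom c)"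
  define \<beta> where "\<beta> = det2 (hom a) (hom b)"
  define \<delta> where "\<delta> = det2 (hom b) (hom c)"
  have nz: "\<alpha> \<noteq> 0" "\<beta> \<noteq> 0" "\<delta> \<noteq> 0"
    using assms by (auto simp: \<alpha>_def \<beta>_def \<delta>_def det2_hom_eq_0_iff)
  define u where "u = (\<lambda>x. (\<alpha> * det2 x (hom b), \<beta> * det2 x (hom c)))"
  define C where "C = norm \<alpha> * 2 * norm (hom b) + norm \<beta> * 2 * norm (hom c)"
  define L where "L = C\<^sup>2 / norm (\<alpha> * \<beta> * \<delta>)"
  have C: "C > 0" unfolding C_def using nz hom_nonzero by (intro add_pos_pos mult_pos_pos) auto
  have nu: "norm (u x) \<le> C * norm x" for x
  proof -
    have "norm (u x) \<le> norm (\<alpha> * det2 x (hom b)) + norm (\<beta> * det2 x (hom c))"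
      unfolding u_def by (rule norm_Pair_le)
    also have "\<dots> \<le> norm \<alpha> * (2 * norm x * norm (hom b)) + norm \<beta> * (2 * norm x * norm (hom c))"
      unfolding norm_mult by (intro add_mono mult_left_mono norm_det2_le) auto
    finally show ?thesis by (simp add: C_def algebra_simps)
  qed
  have detu: "det2 (u x) (u y) = \<alpha> * \<beta> * \<delta> * det2 x y" for x y
    by (simp add: u_def det2_def \<delta>_def algebra_simps)
  have "chordal p q \<le> L * chordal (Some (moeb a b c (hom p))) (Some (moeb a b c (hom q)))"
    if pq: "p \<noteq> c" "q \<noteq> c" for p q
  proof -
    have snz: "snd (u (hom p)) \<noteq> 0" "snd (u (hom q)) \<noteq> 0"
      using pq nz by (auto simp: u_def det2_hom_eq_0_iff)
    then have unz: "u (hom p) \<noteq> 0" "u (hom q) \<noteq> 0" by (auto simp: prod_eq_iff)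
    have m: "moeb a b c x = fst (u x) / snd (u x)" for x
      by (simp add: moeb_def u_def \<alpha>_def \<beta>_def)
    have ch: "chordal (Some (moeb a b c (hom p))) (Some (moeb a b c (hom q)))
        = 2 * norm (det2 (u (hom p)) (u (hom q))) / (norm (u (hom p)) * norm (u (hom q)))"
      by (rule chordal_hom) (use snz unz in \<open>auto simp: m hom_def\<close>)
    have h0: "norm (hom p) > 0" "norm (hom q) > 0" using hom_nonzero by auto
    have u0: "norm (u (hom p)) > 0" "norm (u (hom q)) > 0" using unz by auto
    define d where "d = norm (det2 (hom p) (hom q))"
    have "norm (u (hom p)) * norm (u (hom q)) \<le> (C * norm (hom p)) * (C * norm (hom q))"
      by (intro mult_mono nu) (use C in auto)
    then have le: "norm (u (hom p)) * norm (u (hom q)) \<le> C\<^sup>2 * (norm (hom p) * norm (hom q))"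
      by (simp add: power2_eq_square mult_ac)
    have "chordal p q = 2 * d / (norm (hom p) * norm (hom q))"
      using chordal_hom[of "hom p" p "hom q" q] hom_nonzero by (simp add: d_def)
    also have "\<dots> \<le> 2 * d * C\<^sup>2 / (norm (u (hom p)) * norm (u (hom q)))"
      using mult_left_mono[OF le, of "2 * d"] h0 u0 by (simp add: d_def field_simps)
    also have "\<dots> = L * (2 * norm (det2 (u (hom p)) (u (hom q))) / (norm (u (hom p)) * norm (u (hom q))))"
      using nz by (simp add: detu L_def d_def norm_mult)
    finally show ?thesis unfolding ch .
  qed
  moreover have "L > 0" using C nz by (simp add: L_def)
  ultimately show thesis using that by blast
qed

text \<open>Mercator's parametrisation of the sphere: with \<open>x = Re g\<close>, the height is
  \<open>tanh x\<close> and the radius of the parallel is \<open>1 / cosh x\<close>.\<close>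

lemma stereo_exp:
  "stereo (Some (exp g)) = ((1 / cosh (Re g)) *\<^sub>R cis (Im g), sinh (Re g) / cosh (Re g))"
proof -
  define x where "x = Re g"
  have n: "(norm (exp g))\<^sup>2 = exp x * exp x" by (simp add: x_def power2_eq_square)
  have e: "exp g = of_real (exp x) * cis (Im g)" by (simp add: x_def exp_eq_polar)
  have p: "1 + exp x * exp x > 0" by (simp add: add_pos_pos)
  have ch: "cosh x = (1 + exp x * exp x) / (2 * exp x)"
    by (simp add: cosh_field_def exp_minus divide_simps)
  have sh: "sinh x = (exp x * exp x - 1) / (2 * exp x)"
    by (simp add: sinh_field_def exp_minus divide_simps)
  have "2 / (1 + exp x * exp x) * exp x = 1 / cosh x"
    using p by (simp add: ch)
  moreover have "(exp x * exp x - 1) / (1 + exp x * exp x) = sinh x / cosh x"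
    using p by (simp add: ch sh)
  moreover have "stereo (Some (exp g)) = ((2 / (1 + exp x * exp x) * exp x) *\<^sub>R cis (Im g),
      (exp x * exp x - 1) / (1 + exp x * exp x))"
    unfolding stereo_def option.case n unfolding e scaleR_conv_of_real of_real_mult mult.assoc ..
  ultimately show ?thesis by (simp add: x_def)
qed

text \<open>The hypothesis bounds the spherical derivative of \<open>exp G\<close>, and the claim is
  the mean value inequality along a segment. The factor 3 comes from estimating the three components
  of the velocity separately.\<close>

lemma stereo_exp_lipschitz:
  assumes hol: "G holomorphic_on S" and S: "open S" "convex S"
    and K: "\<And>z. z \<in> S \<Longrightarrow> norm (deriv G z) \<le> K * cosh (Re (G z))"
    and zw: "z \<in> S" "w \<in> S"
  shows "dist (stereo (Some (exp (G z)))) (stereo (Some (exp (G w)))) \<le> 3 * K * dist z w"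
proof -
  define \<gamma> where "\<gamma> = (\<lambda>t. w + of_real t * (z - w))"
  define d where "d = (\<lambda>t. (z - w) * deriv G (\<gamma> t))"
  define x y where "x = (\<lambda>t. Re (G (\<gamma> t)))" and "y = (\<lambda>t. Im (G (\<gamma> t)))"
  define \<Phi> where "\<Phi> = (\<lambda>t. stereo (Some (exp (G (\<gamma> t)))))"
  \<comment> \<open>The velocity of \<Phi>: motion towards the axis, motion along the parallel, and
    change of height.\<close>
  define E where "E = (\<lambda>t. ((- (sinh (x t) * Re (d t)) / (cosh (x t))\<^sup>2) *\<^sub>R cis (y t)
      + (Im (d t) / cosh (x t)) *\<^sub>R (\<i> * cis (y t)), Re (d t) / (cosh (x t))\<^sup>2))"
  have \<gamma>S: "\<gamma> t \<in> S" if "t \<in> {0..1}" for t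
    using convexD_alt[OF S(2) zw(2,1), of t] that
    by (simp add: \<gamma>_def scaleR_conv_of_real algebra_simps)
  have der: "(\<Phi> has_vector_derivative E t) (at t within {0..1})" if t: "t \<in> {0..1}" for t
  proof -
    have "(G has_field_derivative deriv G (\<gamma> t)) (at (\<gamma> t))"
      using hol S \<gamma>S[OF t] by (simp add: holomorphic_derivI)
    moreover have "(\<gamma> has_vector_derivative (z - w)) (at t)"
      unfolding \<gamma>_def by (auto intro!: derivative_eq_intros)
    ultimately have "((G \<circ> \<gamma>) has_vector_derivative d t) (at t)"
      unfolding d_def by (intro field_vector_diff_chain_at) auto
    then have dx: "(x has_real_derivative Re (d t)) (at t)" and dy: "(y has_real_derivative Im (d t)) (at t)"
      by (simp_all add: x_def y_def has_vector_derivative_complex_iff o_def)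
    have c: "cosh (x t) \<noteq> 0" by simp
    have dc: "((\<lambda>t. cosh (x t)) has_real_derivative sinh (x t) * Re (d t)) (at t)"
      and ds: "((\<lambda>t. sinh (x t)) has_real_derivative cosh (x t) * Re (d t)) (at t)"
      by (rule derivative_eq_intros dx refl)+
    have "((\<lambda>t. 1 / cosh (x t)) has_real_derivative
        (0 * cosh (x t) - 1 * (sinh (x t) * Re (d t))) / (cosh (x t) * cosh (x t))) (at t)"
      by (rule DERIV_divide[OF DERIV_const dc c])
    then have d1: "((\<lambda>t. 1 / cosh (x t)) has_real_derivative (- (sinh (x t) * Re (d t)) / (cosh (x t))\<^sup>2)) (at t)"
      by (simp add: power2_eq_square)
    have "((\<lambda>t. sinh (x t) / cosh (x t)) has_real_derivative
        (cosh (x t) * Re (d t) * cosh (x t) - sinh (x t) * (sinh (x t) * Re (d t))) / (cosh (x t) * cosh (x t))) (at t)"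
      by (rule DERIV_divide[OF ds dc c])
    moreover have "cosh (x t) * Re (d t) * cosh (x t) - sinh (x t) * (sinh (x t) * Re (d t))
        = ((cosh (x t))\<^sup>2 - (sinh (x t))\<^sup>2) * Re (d t)"
      by (simp add: power2_eq_square algebra_simps)
    ultimately have d2: "((\<lambda>t. sinh (x t) / cosh (x t)) has_real_derivative (Re (d t) / (cosh (x t))\<^sup>2)) (at t)"
      unfolding hyperbolic_pythagoras by (simp add: power2_eq_square)
    have d3: "((\<lambda>t. cis (y t)) has_vector_derivative Im (d t) *\<^sub>R (\<i> * cis (y t))) (at t)"
      unfolding has_vector_derivative_complex_iff by (auto intro!: derivative_eq_intros dy)
    have "((\<lambda>t. (1 / cosh (x t)) *\<^sub>R cis (y t)) has_vector_derivative
       ((1 / cosh (x t)) *\<^sub>R (Im (d t) *\<^sub>R (\<i> * cis (y t))) + (- (sinh (x t) * Re (d t)) / (cosh (x t))\<^sup>2) *\<^sub>R cis (y t))) (at t)"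
      by (rule has_vector_derivative_scaleR[OF d1 d3])
    then have "((\<lambda>t. ((1 / cosh (x t)) *\<^sub>R cis (y t), sinh (x t) / cosh (x t))) has_vector_derivative E t) (at t)"
      unfolding E_def
      by (intro has_vector_derivative_Pair) (use d2 in \<open>auto simp: has_real_derivative_iff_has_vector_derivative add.commute\<close>)
    moreover have "\<Phi> = (\<lambda>t. ((1 / cosh (x t)) *\<^sub>R cis (y t), sinh (x t) / cosh (x t)))"
      by (simp add: \<Phi>_def stereo_exp x_def y_def)
    ultimately show ?thesis
      by (simp add: has_vector_derivative_at_within)
  qed
  have bd: "norm (E t) \<le> 3 * K * dist z w" if t: "t \<in> {0..1}" for t
  proof -
    define c where "c = cosh (x t)"
    have c: "c \<ge> 1" unfolding c_def by (rule cosh_real_ge_1)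
    have s: "\<bar>sinh (x t)\<bar> \<le> c"
      using sinh_le_cosh_real[of "x t"] sinh_le_cosh_real[of "- x t"] by (auto simp: c_def)
    define e where "e = norm (d t) / c"
    have re: "\<bar>Re (d t)\<bar> / c \<le> e" "\<bar>Im (d t)\<bar> / c \<le> e"
      using c abs_Re_le_cmod abs_Im_le_cmod by (auto simp: e_def divide_simps)
    have "\<bar>sinh (x t)\<bar> / c * (\<bar>Re (d t)\<bar> / c) \<le> 1 * e"
      by (rule mult_mono) (use s c re in \<open>auto simp: divide_simps\<close>)
    then have t1: "\<bar>sinh (x t)\<bar> * \<bar>Re (d t)\<bar> / c\<^sup>2 \<le> e" by (simp add: power2_eq_square)
    have "(1 / c) * (\<bar>Re (d t)\<bar> / c) \<le> 1 * e"
      by (rule mult_mono) (use c re in \<open>auto simp: divide_simps\<close>)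
    then have t2: "\<bar>Re (d t)\<bar> / c\<^sup>2 \<le> e" by (simp add: power2_eq_square)
    have "norm (E t) \<le> norm (fst (E t)) + norm (snd (E t))"
      using norm_Pair_le[of "fst (E t)" "snd (E t)"] by simp
    also have "norm (fst (E t)) \<le> \<bar>sinh (x t)\<bar> * \<bar>Re (d t)\<bar> / c\<^sup>2 + \<bar>Im (d t)\<bar> / c"
      unfolding E_def fst_conv
      by (rule norm_triangle_le) (use c in \<open>simp add: norm_mult abs_mult c_def\<close>)
    also have "norm (snd (E t)) = \<bar>Re (d t)\<bar> / c\<^sup>2" using c by (simp add: E_def c_def)
    finally have "norm (E t) \<le> 3 * e" using t1 t2 re by simp
    also have "e \<le> K * dist z w"
    proof -
      have "norm (d t) \<le> dist z w * (K * c)"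
        unfolding d_def norm_mult c_def x_def dist_norm by (intro mult_left_mono K \<gamma>S t) auto
      then show ?thesis using c by (simp add: e_def field_simps)
    qed
    finally show ?thesis by simp
  qed
  have "norm (\<Phi> 1 - \<Phi> 0) \<le> 3 * K * dist z w * norm (1 - 0 :: real)"
  proof (rule differentiable_bound[of "{0..1}" \<Phi> "\<lambda>t h. h *\<^sub>R E t"])
    show "onorm (\<lambda>h. h *\<^sub>R E t) \<le> 3 * K * dist z w" if "t \<in> {0..1}" for t
    proof (rule onorm_le)
      fix h :: real
      have "\<bar>h\<bar> * norm (E t) \<le> \<bar>h\<bar> * (3 * K * dist z w)"
        by (intro mult_left_mono bd that) simp
      then show "norm (h *\<^sub>R E t) \<le> 3 * K * dist z w * norm h"
        by (simp only: norm_scaleR real_norm_def mult.commute)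
    qed
    show "(\<Phi> has_derivative (\<lambda>h. h *\<^sub>R E t)) (at t within {0..1})" if "t \<in> {0..1}" for t
      using der[OF that] unfolding has_vector_derivative_def .
  qed auto
  then show ?thesis by (simp add: \<Phi>_def \<gamma>_def dist_norm)
qed

section \<open>Local equicontinuity\<close>

lemma ramified_logarithm_bound_ball:
  assumes hol: "G holomorphic_on ball z0 r" and r: "r > 0"
    and ram: "\<And>z. z \<in> ball z0 r \<Longrightarrow> exp (G z) = 1 \<Longrightarrow> deriv G z = 0"
  shows "norm (deriv G z0) \<le> 24000 / r * cosh (Re (G z0))"
proof -
  define \<gamma> where "\<gamma> = (\<lambda>\<zeta>. z0 + of_real r * \<zeta>)"
  define H where "H = (\<lambda>\<zeta>. G (\<gamma> \<zeta>))"
  have \<gamma>b: "\<gamma> \<zeta> \<in> ball z0 r" if "\<zeta> \<in> ball 0 1" for \<zeta>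
    using that r by (simp add: \<gamma>_def dist_norm norm_mult)
  have holH: "H holomorphic_on ball 0 1"
    unfolding H_def
    by (rule holomorphic_on_compose_gen[OF _ hol, unfolded o_def])
       (use \<gamma>b in \<open>auto intro!: holomorphic_intros simp: \<gamma>_def\<close>)
  have dH: "deriv H \<zeta> = deriv G (\<gamma> \<zeta>) * of_real r" if "\<zeta> \<in> ball 0 1" for \<zeta>
  proof (rule DERIV_imp_deriv)
    have "(G has_field_derivative deriv G (\<gamma> \<zeta>)) (at (\<gamma> \<zeta>))"
      using holomorphic_derivI[OF hol open_ball \<gamma>b[OF that]] .
    then show "(H has_field_derivative deriv G (\<gamma> \<zeta>) * of_real r) (at \<zeta>)"
      unfolding H_def by (rule DERIV_chain2) (auto intro!: derivative_eq_intros simp: \<gamma>_def)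
  qed
  have "norm (deriv H 0) \<le> 24000 * cosh (Re (H 0))"
  proof (rule ramified_logarithm_bound[OF holH])
    show "deriv H z = 0" if "z \<in> ball 0 1" "exp (H z) = 1" for z
      using ram[OF \<gamma>b[OF that(1)]] that(2) dH[OF that(1)] by (simp add: H_def)
  qed
  then show ?thesis using r dH[of 0] by (simp add: H_def \<gamma>_def norm_mult field_simps)
qed

section \<open>Meromorphic functions near ordinary points and poles\<close>

lemma deriv_eq_0_of_zorder:
  assumes "g holomorphic_on S" "open S" "z \<in> S" "g z = 0" "zorder g z \<ge> 2"
  shows "deriv g z = 0"
proof (rule ccontr)
  assume "deriv g z \<noteq> 0"
  then have "zorder g z = 1"
    using assms by (intro zorder_zero_eqI[of g S z 1]) auto
  then show False using assms by simp
qed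

lemma ext_val_simps [simp]:
  "is_pole f z \<Longrightarrow> ext_val f z = None" "\<not> is_pole f z \<Longrightarrow> ext_val f z = Some (f z)"
  "ext_val f z = None \<longleftrightarrow> is_pole f z"
  by (auto simp: ext_val_def)

lemma nicely_meromorphic_no_pole_ball:
  assumes "f nicely_meromorphic_on A" "open A" "z \<in> A" "\<not> is_pole f z"
  obtains r where "r > 0" "ball z r \<subseteq> A" "f holomorphic_on ball z r"
    "\<And>w. w \<in> ball z r \<Longrightarrow> \<not> is_pole f w"
proof -
  have "f analytic_on {z}" using assms nicely_meromorphic_on_imp_analytic_at by blast
  then obtain r1 where r1: "r1 > 0" "f holomorphic_on ball z r1" by (auto simp: analytic_on_def)
  obtain r2 where r2: "r2 > 0" "ball z r2 \<subseteq> A" using assms openE by blast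
  define r where "r = min r1 r2"
  have "f holomorphic_on ball z r" using r1 by (auto simp: r_def intro: holomorphic_on_subset)
  moreover have "r > 0" "ball z r \<subseteq> A" using r1 r2 by (auto simp: r_def)
  ultimately show thesis using that not_is_pole_holomorphic[OF open_ball] by blast
qed

lemma nicely_meromorphic_pole_ball:
  assumes "f nicely_meromorphic_on A" "open A" "z \<in> A" "is_pole f z"
  obtains r where "r > 0" "ball z r \<subseteq> A"
    "(\<lambda>w. if w = z then 0 else inverse (f w)) holomorphic_on ball z r"
    "\<And>w. w \<in> ball z r \<Longrightarrow> w \<noteq> z \<Longrightarrow> \<not> is_pole f w \<and> f w \<noteq> 0"
proof -
  have "isolated_singularity_at f z"
    using assms(1,3) unfolding nicely_meromorphic_on_def
    by (meson empty_subsetI insert_subset meromorphic_at_iff meromorphic_on_subset)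
  then obtain r1 where r1: "r1 > 0" "f holomorphic_on ball z r1 - {z}"
    by (auto simp: isolated_singularity_at_def dest: analytic_imp_holomorphic)
  have "\<forall>\<^sub>F w in at z. f w \<noteq> 0" using assms(4) by (rule non_zero_neighbour_pole)
  then obtain r3 where r3: "r3 > 0" "\<And>w. w \<noteq> z \<Longrightarrow> dist w z < r3 \<Longrightarrow> f w \<noteq> 0"
    by (auto simp: eventually_at)
  obtain r2 where r2: "r2 > 0" "ball z r2 \<subseteq> A" using assms openE by blast
  define r where "r = min r1 (min r2 r3)"
  have r: "r > 0" "ball z r \<subseteq> A" using r1 r2 r3 by (auto simp: r_def)
  have hol: "f holomorphic_on ball z r - {z}"
    using r1 by (auto simp: r_def intro: holomorphic_on_subset)
  have nz: "f w \<noteq> 0" if "w \<in> ball z r" "w \<noteq> z" for w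
    using r3 that by (auto simp: r_def dist_commute)
  have "(\<lambda>w. if w = z then 0 else inverse (f w)) holomorphic_on ball z r"
    using hol assms(4) nz by (intro is_pole_inverse_holomorphic) auto
  moreover have "\<not> is_pole f w" if "w \<in> ball z r" "w \<noteq> z" for w
    using not_is_pole_holomorphic[OF _ _ hol] that by (auto simp: open_delete)
  ultimately show thesis using that r nz by blast
qed

text \<open>The coordinates are \<open>(f, 1)\<close> near an ordinary point and
  \<open>(1, 1/f)\<close> near a pole. A multiple point makes the derivatives of both coordinates
  vanish, which treats finite values and infinity alike and survives every Moebius map.\<close>

lemma homogeneous_chart:
  assumes f: "f nicely_meromorphic_on A" and A: "open A" "z \<in> A"
  obtains r u v where "r > 0" "ball z r \<subseteq> A" "u holomorphic_on ball z r" "v holomorphic_on ball z r"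
    "\<And>w. w \<in> ball z r \<Longrightarrow> (u w, v w) \<noteq> 0"
    "\<And>w. w \<in> ball z r \<Longrightarrow> u w * snd (hom (ext_val f w)) = v w * fst (hom (ext_val f w))"
    "apoint_mult f (ext_val f z) z \<ge> 2 \<Longrightarrow> deriv u z = 0 \<and> deriv v z = 0"
proof (cases "is_pole f z")
  case False
  then obtain r where r: "r > 0" "ball z r \<subseteq> A" "f holomorphic_on ball z r"
    "\<And>w. w \<in> ball z r \<Longrightarrow> \<not> is_pole f w"
    using nicely_meromorphic_no_pole_ball[OF f A] by blast
  have "deriv f z = 0" if *: "apoint_mult f (ext_val f z) z \<ge> 2"
  \<comment> \<open>In the locally constant case the multiplicity is infinite and
    \<open>zorder\<close> says nothing, so the derivative is computed directly.\<close>
  proof (cases "eventually (\<lambda>w. f w = f z) (at z)")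
    case True
    then have "eventually (\<lambda>w. f w = f z) (nhds z)" by (auto simp: eventually_at_filter elim: eventually_mono)
    then have "deriv f z = deriv (\<lambda>_. f z) z" by (intro deriv_cong_ev) auto
    then show ?thesis by simp
  next
    case nc: False
    then have "(2::enat) \<le> enat (nat (zorder (\<lambda>w. f w - f z) z))"
      using * False by (simp add: apoint_mult_def)
    then have "zorder (\<lambda>w. f w - f z) z \<ge> 2"
      by (simp add: numeral_eq_enat)
    then have "deriv (\<lambda>w. f w - f z) z = 0"
      using r by (intro deriv_eq_0_of_zorder[of _ "ball z r"]) (auto intro: holomorphic_intros)
    moreover have "deriv (\<lambda>w. f w - f z) z = deriv f z - deriv (\<lambda>w. f z) z"
      using r by (intro deriv_diff) (auto simp: holomorphic_on_imp_differentiable_at)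
    ultimately show ?thesis by simp
  qed
  then show thesis
    using r by (intro that[of r f "\<lambda>_. 1"]) (auto simp: hom_def zero_prod_def)
next
  case True
  \<comment> \<open>The reciprocal with its removable singularity filled in; the order of its zero
    at \<open>z\<close> is the order of the pole of \<open>f\<close>.\<close>
  define v where "v = (\<lambda>w. if w = z then 0 else inverse (f w))"
  obtain r where r: "r > 0" "ball z r \<subseteq> A" "v holomorphic_on ball z r"
    "\<And>w. w \<in> ball z r \<Longrightarrow> w \<noteq> z \<Longrightarrow> \<not> is_pole f w \<and> f w \<noteq> 0"
    using nicely_meromorphic_pole_ball[OF f A True] unfolding v_def by blast
  have "deriv v z = 0" if *: "apoint_mult f (ext_val f z) z \<ge> 2"
  proof -
    have "(2::enat) \<le> enat (nat (- zorder f z))"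
      using * True by (simp add: apoint_mult_def)
    then have "- zorder f z \<ge> 2"
      by (simp add: numeral_eq_enat)
    moreover have "zorder v z = zorder (\<lambda>w. inverse (f w)) z"
      by (intro zorder_cong) (auto simp: v_def eventually_at_filter)
    moreover have "zorder (\<lambda>w. inverse (f w)) z = - zorder f z"
    proof (rule zorder_inverse)
      show "isolated_singularity_at f z"
        using f A(2) unfolding nicely_meromorphic_on_def
        by (meson empty_subsetI insert_subset meromorphic_at_iff meromorphic_on_subset)
      show "not_essential f z" using True by blast
      show "\<exists>\<^sub>F w in at z. f w \<noteq> 0"
        using non_zero_neighbour_pole[OF True] by (intro eventually_frequently) auto
    qed
    ultimately show ?thesis
      using r by (intro deriv_eq_0_of_zorder[of _ "ball z r"]) (auto simp: v_def)
  qed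
  moreover have "1 * snd (hom (ext_val f w)) = v w * fst (hom (ext_val f w))" if "w \<in> ball z r" for w
    using r(4)[OF that] True by (cases "w = z") (auto simp: hom_def v_def)
  ultimately show thesis
    using r by (intro that[of r "\<lambda>_. 1" v]) (auto simp: zero_prod_def)
qed

text \<open>In a chart, the chordal distance to the value at \<open>z\<close> is a quotient of
  continuous functions with nonzero denominator, and it vanishes at \<open>z\<close>.\<close>

lemma continuous_stereo_ext_val:
  assumes f: "f nicely_meromorphic_on A" and A: "open A" "z \<in> A"
  shows "isCont (\<lambda>w. stereo (ext_val f w)) z"
proof -
  obtain r u v where r: "r > 0" and "ball z r \<subseteq> A"
    and hol: "u holomorphic_on ball z r" "v holomorphic_on ball z r"
    and nz: "\<And>w. w \<in> ball z r \<Longrightarrow> (u w, v w) \<noteq> 0"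
    and h: "\<And>w. w \<in> ball z r \<Longrightarrow> u w * snd (hom (ext_val f w)) = v w * fst (hom (ext_val f w))"
    and "apoint_mult f (ext_val f z) z \<ge> 2 \<Longrightarrow> deriv u z = 0 \<and> deriv v z = 0"
    by (rule homogeneous_chart[OF f A]) (rule that; assumption)
  have ev: "\<forall>\<^sub>F w in at z. w \<in> ball z r"
    using r by (intro eventually_at_in_open') auto
  have cont: "isCont u z" "isCont v z"
    using hol[THEN holomorphic_on_imp_continuous_on] r
    by (auto intro: continuous_on_interior)
  have nz0: "(u z, v z) \<noteq> 0" using nz r by simp
  define c where "c = (\<lambda>w. 2 * norm (det2 (u w, v w) (u z, v z)) / (norm (u w, v w) * norm (u z, v z)))"
  have "(c \<longlongrightarrow> c z) (at z)"
    unfolding c_def det2_def fst_conv snd_conv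
    by (intro tendsto_intros cont[THEN isContD]) (use nz0 in auto)
  moreover have "c z = 0" by (simp add: c_def det2_def)
  ultimately have "(c \<longlongrightarrow> 0) (at z)" by simp
  moreover have "\<forall>\<^sub>F w in at z. c w = dist (stereo (ext_val f w)) (stereo (ext_val f z))"
    using ev
  proof eventually_elim
    case (elim w)
    then show ?case
      using chordal_hom[of "(u w, v w)" "ext_val f w" "(u z, v z)" "ext_val f z"] nz h r
      by (simp add: c_def chordal_eq_dist)
  qed
  ultimately have "((\<lambda>w. dist (stereo (ext_val f w)) (stereo (ext_val f z))) \<longlongrightarrow> 0) (at z)"
    by (rule Lim_transform_eventually)
  then show ?thesis unfolding isCont_def by (rule tendsto_dist_iff[THEN iffD2])
qed

text \<open>The normality criterion in quantitative form: \<open>L\<close> depends on the three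
  values only. The Moebius image \<open>F\<close> of \<open>f\<close> is holomorphic without zeros,
  so \<open>F = exp G\<close>, and the multiple \<open>a\<close>-points of \<open>f\<close> are the
  points where \<open>exp G = 1\<close>, which makes \<open>G'\<close> vanish there.\<close>

lemma equilipschitz_of_two_omitted_one_ramified:
  assumes abc: "distinct [a, b, c]"
  obtains L where "L > 0" and "\<And>f z0 r z w. r > 0 \<Longrightarrow> f nicely_meromorphic_on ball z0 r \<Longrightarrow>
      (\<And>x. x \<in> ball z0 r \<Longrightarrow> ext_val f x \<noteq> b \<and> ext_val f x \<noteq> c) \<Longrightarrow>
      (\<And>x. x \<in> ball z0 r \<Longrightarrow> ext_val f x = a \<Longrightarrow> apoint_mult f a x \<ge> 2) \<Longrightarrow>
      z \<in> ball z0 (r / 2) \<Longrightarrow> w \<in> ball z0 (r / 2) \<Longrightarrow>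
      chordal (ext_val f z) (ext_val f w) \<le> L / r * dist z w"
proof -
  obtain M where M: "M > 0" and chM: "\<And>p q. p \<noteq> c \<Longrightarrow> q \<noteq> c \<Longrightarrow>
    chordal p q \<le> M * chordal (Some (moeb a b c (hom p))) (Some (moeb a b c (hom q)))"
    using chordal_le_chordal_moeb[OF abc] by blast
  \<comment> \<open>The factor is \<open>3 * 2 * 24000\<close>: 3 from the mean value inequality, 2
    from applying the derivative bound on balls of radius \<open>r / 2\<close>, and 24000 from that
    bound.\<close>
  define L where "L = M * 144000"
  have "chordal (ext_val f z) (ext_val f w) \<le> L / r * dist z w"
    if r: "r > 0" and f: "f nicely_meromorphic_on ball z0 r"
      and om: "\<And>x. x \<in> ball z0 r \<Longrightarrow> ext_val f x \<noteq> b \<and> ext_val f x \<noteq> c"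
      and ram: "\<And>x. x \<in> ball z0 r \<Longrightarrow> ext_val f x = a \<Longrightarrow> apoint_mult f a x \<ge> 2"
      and zw: "z \<in> ball z0 (r / 2)" "w \<in> ball z0 (r / 2)" for f z0 r z w
  proof -
    define F where "F = (\<lambda>x. moeb a b c (hom (ext_val f x)))"
    \<comment> \<open>Charts are needed because \<open>f\<close> may have poles in the ball although
      \<open>F\<close> has none.\<close>
    have F: "F field_differentiable at x \<and> (F x = 1 \<longrightarrow> deriv F x = 0)" if x: "x \<in> ball z0 r" for x
    proof -
      obtain s u v where s: "s > 0" "ball x s \<subseteq> ball z0 r"
        and hol: "u holomorphic_on ball x s" "v holomorphic_on ball x s"
        and nz: "\<And>y. y \<in> ball x s \<Longrightarrow> (u y, v y) \<noteq> 0"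
        and h: "\<And>y. y \<in> ball x s \<Longrightarrow> u y * snd (hom (ext_val f y)) = v y * fst (hom (ext_val f y))"
        and mult: "apoint_mult f (ext_val f x) x \<ge> 2 \<Longrightarrow> deriv u x = 0 \<and> deriv v x = 0"
        by (rule homogeneous_chart[OF f open_ball x]) (rule that; assumption)
      define \<alpha> where "\<alpha> = det2 (hom a) (hom c)"
      define \<beta> where "\<beta> = det2 (hom a) (hom b)"
      define P where "P = (\<lambda>y. \<alpha> * (u y * snd (hom b) - v y * fst (hom b)))"
      define Q where "Q = (\<lambda>y. \<beta> * (u y * snd (hom c) - v y * fst (hom c)))"
      have FPQ: "F y = P y / Q y" if "y \<in> ball x s" for y
        using moeb_scale[of "(u y, v y)" "ext_val f y" a b c] h[OF that] nz[OF that]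
        by (simp add: F_def P_def Q_def moeb_def \<alpha>_def \<beta>_def det2_def)
      have xs: "x \<in> ball x s" using s by simp
      \<comment> \<open>A zero of the denominator would mean that \<open>f\<close> takes the omitted
        value \<open>c\<close> at \<open>x\<close>.\<close>
      have Qx: "Q x \<noteq> 0"
      proof
        assume "Q x = 0"
        moreover have "\<beta> \<noteq> 0" using abc by (auto simp: \<beta>_def det2_hom_eq_0_iff)
        ultimately have "u x * snd (hom c) = v x * fst (hom c)" by (simp add: Q_def)
        then have "chordal (ext_val f x) c = 2 * norm (det2 (u x, v x) (u x, v x)) / (norm (u x, v x) * norm (u x, v x))"
          using nz[OF xs] h[OF xs] by (intro chordal_hom) auto
        then have "chordal (ext_val f x) c = 0" by (simp add: det2_def)
        then show False using om[OF x] by (simp add: chordal_eq_dist stereo_inject)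
      qed
      have du: "(u has_field_derivative deriv u x) (at x)" "(v has_field_derivative deriv v x) (at x)"
        using hol xs by (auto intro: holomorphic_derivI)
      have dPQ: "(P has_field_derivative \<alpha> * (deriv u x * snd (hom b) - deriv v x * fst (hom b))) (at x)"
        "(Q has_field_derivative \<beta> * (deriv u x * snd (hom c) - deriv v x * fst (hom c))) (at x)"
        unfolding P_def Q_def by (auto intro!: derivative_eq_intros du)
      define e where "e = ((\<alpha> * (deriv u x * snd (hom b) - deriv v x * fst (hom b))) * Q x
          - P x * (\<beta> * (deriv u x * snd (hom c) - deriv v x * fst (hom c)))) / (Q x * Q x)"
      have "((\<lambda>y. P y / Q y) has_field_derivative e) (at x)"
        unfolding e_def by (rule DERIV_divide[OF dPQ Qx])
      then have dF: "(F has_field_derivative e) (at x)"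
        by (rule has_field_derivative_transform_within_open[of _ _ _ "ball x s"]) (use FPQ s in auto)
      \<comment> \<open>The numerator of the derivative is linear in \<open>deriv u x\<close> and
        \<open>deriv v x\<close>, and both vanish at a multiple point.\<close>
      moreover have "e = 0" if "F x = 1"
      proof -
        have "ext_val f x = a"
          using moeb_eq_1[OF abc, of "ext_val f x"] om[OF x] that by (simp add: F_def)
        then have "deriv u x = 0 \<and> deriv v x = 0" using mult ram[OF x] by simp
        then show ?thesis by (simp add: e_def)
      qed
      ultimately show ?thesis
        using DERIV_imp_deriv field_differentiable_def by blast
    qed
    have holF: "F holomorphic_on ball z0 r"
      using F by (simp add: holomorphic_on_def field_differentiable_at_within)
    have Fnz: "F x \<noteq> 0" if "x \<in> ball z0 r" for x
      using moeb_eq_0_iff[of a b c "ext_val f x"] abc om[OF that] by (auto simp: F_def)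
    obtain G where G: "G holomorphic_on ball z0 r" "\<And>x. x \<in> ball z0 r \<Longrightarrow> exp (G x) = F x"
      using holomorphic_logarithm_exists[of "ball z0 r" F z0] holF Fnz r by auto
    have ramG: "deriv G x = 0" if x: "x \<in> ball z0 r" "exp (G x) = 1" for x
    proof -
      have "(G has_field_derivative deriv G x) (at x)"
        using G(1) x by (auto intro: holomorphic_derivI)
      then have "((\<lambda>y. exp (G y)) has_field_derivative exp (G x) * deriv G x) (at x)"
        by (rule DERIV_fun_exp)
      then have "(F has_field_derivative exp (G x) * deriv G x) (at x)"
        by (rule has_field_derivative_transform_within_open[of _ _ _ "ball z0 r"]) (use G x in auto)
      then have "deriv F x = deriv G x" using x by (simp add: DERIV_imp_deriv)
      then show ?thesis using F[OF x(1)] G(2)[OF x(1)] x(2) by simp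
    qed
    have bd: "norm (deriv G x) \<le> (48000 / r) * cosh (Re (G x))" if x: "x \<in> ball z0 (r / 2)" for x
    proof -
      have sub: "ball x (r / 2) \<subseteq> ball z0 r"
      proof
        fix y assume "y \<in> ball x (r / 2)"
        then show "y \<in> ball z0 r" using x dist_triangle[of z0 y x] by simp
      qed
      have "norm (deriv G x) \<le> 24000 / (r / 2) * cosh (Re (G x))"
        using ramG sub r by (intro ramified_logarithm_bound_ball holomorphic_on_subset[OF G(1)]) auto
      then show ?thesis by simp
    qed
    have half: "ball z0 (r / 2) \<subseteq> ball z0 r" using r by (intro subset_ball) simp
    then have zw': "z \<in> ball z0 r" "w \<in> ball z0 r" using zw by auto
    have "dist (stereo (Some (exp (G z)))) (stereo (Some (exp (G w)))) \<le> 3 * (48000 / r) * dist z w"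
      using half by (intro stereo_exp_lipschitz[of G "ball z0 (r / 2)"] bd zw holomorphic_on_subset[OF G(1)]) auto
    then have "chordal (Some (F z)) (Some (F w)) \<le> 144000 / r * dist z w"
      using G(2) zw half by (simp add: chordal_eq_dist subset_iff)
    then have "M * chordal (Some (F z)) (Some (F w)) \<le> M * (144000 / r * dist z w)"
      using M by (intro mult_left_mono) auto
    moreover have "chordal (ext_val f z) (ext_val f w) \<le> M * chordal (Some (F z)) (Some (F w))"
      unfolding F_def using om[OF zw'(1)] om[OF zw'(2)] by (intro chM) auto
    ultimately show ?thesis by (simp add: L_def)
  qed
  moreover have "L > 0" using M by (simp add: L_def)
  ultimately show thesis using that by blast
qed

section \<open>Spherical limits\<close>

text \<open>Away from infinity the chordal and the Euclidean metric are comparable, so this reduces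
  to Weierstrass's theorem on uniform limits of holomorphic functions.\<close>

lemma holomorphic_spherical_limit:
  assumes hol: "\<And>n. n \<ge> N \<Longrightarrow> g n holomorphic_on ball z \<rho>" and e: "e > 0"
    and ge: "\<And>n w. n \<ge> N \<Longrightarrow> w \<in> ball z \<rho> \<Longrightarrow> chordal (Some (g n w)) None \<ge> e"
    and qe: "\<And>w. w \<in> ball z \<rho> \<Longrightarrow> chordal (Some (q w)) None \<ge> e"
    and ul: "uniform_limit (ball z \<rho>) (\<lambda>n w. stereo (Some (g n w))) (\<lambda>w. stereo (Some (q w))) sequentially"
  shows "q holomorphic_on ball z \<rho>"
proof -
  have bound: "sqrt (1 + (norm x)\<^sup>2) \<le> 2 / e" if "chordal (Some x) None \<ge> e" for x
    using that e by (simp add: field_simps)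
  have ineq: "dist x y \<le> (2 / e\<^sup>2) * dist (stereo (Some x)) (stereo (Some y))"
    if "chordal (Some x) None \<ge> e" "chordal (Some y) None \<ge> e" for x y
  proof -
    define s t where "s = sqrt (1 + (norm x)\<^sup>2)" and "t = sqrt (1 + (norm y)\<^sup>2)"
    have st: "s > 0" "t > 0" by (auto simp: s_def t_def)
    have "s * t \<le> (2 / e) * (2 / e)"
      unfolding s_def t_def using e by (intro mult_mono bound that) auto
    then have st2: "s * t / 2 \<le> 2 / e\<^sup>2" by (simp add: power2_eq_square)
    have "dist x y = (s * t / 2) * chordal (Some x) (Some y)"
      using st by (simp add: s_def[symmetric] t_def[symmetric] dist_norm)
    also have "\<dots> \<le> (2 / e\<^sup>2) * chordal (Some x) (Some y)"
      by (rule mult_right_mono[OF st2]) (simp add: chordal_eq_dist del: chordal.simps)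
    finally show ?thesis by (simp add: chordal_eq_dist del: chordal.simps)
  qed
  \<comment> \<open>The shift by \<open>N\<close> discards the finitely many functions that need not
    be holomorphic.\<close>
  have lim: "uniform_limit (ball z \<rho>) (\<lambda>n. g (n + N)) q sequentially"
  proof (rule uniform_limitI)
    fix \<epsilon> :: real assume \<epsilon>: "\<epsilon> > 0"
    have "\<epsilon> / (2 / e\<^sup>2) > 0" using \<epsilon> e by simp
    then have "\<forall>\<^sub>F n in sequentially. \<forall>w\<in>ball z \<rho>.
        dist (stereo (Some (g n w))) (stereo (Some (q w))) < \<epsilon> / (2 / e\<^sup>2)"
      by (rule uniform_limitD[OF ul])
    then obtain M where M: "\<And>n w. n \<ge> M \<Longrightarrow> w \<in> ball z \<rho> \<Longrightarrow>
        dist (stereo (Some (g n w))) (stereo (Some (q w))) < \<epsilon> / (2 / e\<^sup>2)"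
      unfolding eventually_sequentially by blast
    have "dist (g (n + N) w) (q w) < \<epsilon>" if "n \<ge> M" "w \<in> ball z \<rho>" for n w
    proof -
      have "dist (g (n + N) w) (q w) \<le> (2 / e\<^sup>2) * dist (stereo (Some (g (n + N) w))) (stereo (Some (q w)))"
        using ge[of "n + N" w] qe[of w] that by (intro ineq) auto
      also have "\<dots> < (2 / e\<^sup>2) * (\<epsilon> / (2 / e\<^sup>2))"
        using M[of "n + N" w] that e by (intro mult_strict_left_mono) auto
      finally show ?thesis using e by simp
    qed
    then show "\<forall>\<^sub>F n in sequentially. \<forall>w\<in>ball z \<rho>. dist (g (n + N) w) (q w) < \<epsilon>"
      unfolding eventually_sequentially by blast
  qed
  show ?thesis
  proof (rule holomorphic_uniform_sequence[of _ "\<lambda>n. g (n + N)"])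
    fix x assume "x \<in> ball z \<rho>"
    then obtain d where d: "d > 0" "cball x d \<subseteq> ball z \<rho>"
      using open_contains_cball open_ball by blast
    then show "\<exists>d>0. cball x d \<subseteq> ball z \<rho> \<and> uniform_limit (cball x d) (\<lambda>n. g (n + N)) q sequentially"
      using uniform_limit_on_subset[OF lim] by blast
  qed (use hol in auto)
qed

text \<open>The reciprocal as a finite number; at \<open>Some 0\<close> it takes the dummy value
  \<open>0\<close>, so the lemmas about it exclude that point.\<close>

definition recip :: "complex option \<Rightarrow> complex" where
  "recip p = (case p of None \<Rightarrow> 0 | Some c \<Rightarrow> inverse c)"

text \<open>Inversion is a rotation of the sphere. In coordinates, \<open>(1, recip p)\<close>
  represents \<open>p\<close>, and inversion swaps the two entries.\<close>

lemma chordal_recip: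
  assumes "p \<noteq> Some 0" "q \<noteq> Some 0"
  shows "chordal (Some (recip p)) (Some (recip q)) = chordal p q"
    and "chordal (Some (recip p)) None = chordal p (Some 0)"
proof -
  have p: "1 * snd (hom p) = recip p * fst (hom p)" if "p \<noteq> Some 0" for p
    using that by (cases p) (auto simp: hom_def recip_def)
  have nz: "(1, x) \<noteq> (0 :: complex \<times> complex)" "(x, 1) \<noteq> (0 :: complex \<times> complex)" for x
    by (auto simp: zero_prod_def)
  have 1: "chordal p q = 2 * norm (det2 (1, recip p) (1, recip q)) / (norm (1::complex, recip p) * norm (1::complex, recip q))"
    by (rule chordal_hom) (use p assms nz in auto)
  show "chordal (Some (recip p)) (Some (recip q)) = chordal p q"
    unfolding 1 by (simp add: det2_def norm_Pair norm_minus_commute)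
  have 2: "chordal p (Some 0) = 2 * norm (det2 (1, recip p) (0, 1)) / (norm (1::complex, recip p) * norm (0::complex, 1::complex))"
    by (rule chordal_hom) (use p assms nz in \<open>auto simp: hom_def\<close>)
  show "chordal (Some (recip p)) None = chordal p (Some 0)"
    unfolding 2 by (simp add: det2_def norm_Pair)
qed

lemma recip_ext_val_holomorphic:
  assumes f: "f nicely_meromorphic_on A" and A: "open A" and nz: "\<And>w. w \<in> A \<Longrightarrow> ext_val f w \<noteq> Some 0"
  shows "(\<lambda>w. recip (ext_val f w)) holomorphic_on A"
proof -
  have "(\<lambda>w. recip (ext_val f w)) field_differentiable at z" if z: "z \<in> A" for z
  proof (cases "is_pole f z")
    case False
    then obtain r where r: "r > 0" "ball z r \<subseteq> A" "f holomorphic_on ball z r"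
      "\<And>w. w \<in> ball z r \<Longrightarrow> \<not> is_pole f w"
      using nicely_meromorphic_no_pole_ball[OF f A z] by blast
    have "(\<lambda>w. inverse (f w)) holomorphic_on ball z r"
      using r nz by (intro holomorphic_intros) (force simp: subset_iff)+
    then have "(\<lambda>w. recip (ext_val f w)) holomorphic_on ball z r"
      by (rule holomorphic_transform) (use r(4) in \<open>simp add: recip_def\<close>)
    then show ?thesis using r(1) by (simp add: holomorphic_on_imp_differentiable_at)
  next
    case True
    then obtain r where r: "r > 0" "ball z r \<subseteq> A"
      "(\<lambda>w. if w = z then 0 else inverse (f w)) holomorphic_on ball z r"
      "\<And>w. w \<in> ball z r \<Longrightarrow> w \<noteq> z \<Longrightarrow> \<not> is_pole f w \<and> f w \<noteq> 0"
      using nicely_meromorphic_pole_ball[OF f A z] by blast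
    from r(3) have "(\<lambda>w. recip (ext_val f w)) holomorphic_on ball z r"
      by (rule holomorphic_transform) (use r(4) True in \<open>auto simp: recip_def\<close>)
    then show ?thesis using r(1) by (simp add: holomorphic_on_imp_differentiable_at)
  qed
  then show ?thesis by (simp add: holomorphic_on_def field_differentiable_at_within)
qed

text \<open>A uniform limit of continuous maps is continuous. If \<open>h z\<close> has distance
  \<open>3 * e\<close> from \<open>p\<close>, then nearby values of \<open>h\<close> keep distance
  \<open>2 * e\<close>, and those of \<open>f n\<close> keep distance \<open>e\<close> once
  \<open>n\<close> is large.\<close>

lemma eventually_away_from_value:
  assumes f: "\<And>n. f n nicely_meromorphic_on ball z r" and r: "r > 0"
    and ul: "uniform_limit (ball z r) (\<lambda>n w. stereo (ext_val (f n) w)) (\<lambda>w. stereo (h w)) sequentially"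
    and p: "h z \<noteq> p"
  obtains \<rho> e N where "0 < \<rho>" "\<rho> \<le> r" "e > 0"
    "\<And>n w. n \<ge> N \<Longrightarrow> w \<in> ball z \<rho> \<Longrightarrow> chordal (ext_val (f n) w) p \<ge> e"
    "\<And>w. w \<in> ball z \<rho> \<Longrightarrow> chordal (h w) p \<ge> e"
proof -
  have "continuous_on (ball z r) (\<lambda>w. stereo (ext_val (f n) w))" for n
    using continuous_stereo_ext_val[OF f open_ball] by (simp add: continuous_on_eq_continuous_at)
  then have "continuous_on (ball z r) (\<lambda>w. stereo (h w))"
    by (intro uniform_limit_theorem[OF _ ul]) auto
  then have cont: "isCont (\<lambda>w. stereo (h w)) z"
    using r by (simp add: continuous_on_eq_continuous_at)
  define e where "e = chordal (h z) p / 3"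
  have e: "e > 0" using p by (simp add: e_def chordal_eq_dist stereo_inject)
  obtain d where d: "d > 0" "\<And>w. dist w z < d \<Longrightarrow> dist (stereo (h w)) (stereo (h z)) < e"
    using cont e unfolding continuous_at_eps_delta by blast
  obtain N where N: "\<And>n w. n \<ge> N \<Longrightarrow> w \<in> ball z r \<Longrightarrow> dist (stereo (ext_val (f n) w)) (stereo (h w)) < e"
    using uniform_limitD[OF ul e] unfolding eventually_sequentially by blast
  have hz: "dist (stereo (h z)) (stereo p) = 3 * e" by (simp add: e_def chordal_eq_dist)
  have h2: "dist (stereo (h w)) (stereo p) \<ge> 2 * e" if "w \<in> ball z (min d r)" for w
    using d(2)[of w] that hz dist_triangle[of "stereo (h z)" "stereo p" "stereo (h w)"]
    by (simp add: dist_commute)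
  show thesis
  proof (rule that[of "min d r" e N])
    fix n w assume n: "n \<ge> N" and w: "w \<in> ball z (min d r)"
    show "chordal (ext_val (f n) w) p \<ge> e"
      using N[OF n, of w] w h2[OF w]
        dist_triangle[of "stereo (h w)" "stereo p" "stereo (ext_val (f n) w)"]
      by (simp add: chordal_eq_dist dist_commute)
  next
    fix w assume "w \<in> ball z (min d r)"
    then show "chordal (h w) p \<ge> e" using h2[of w] e by (simp add: chordal_eq_dist)
  qed (use d r e in auto)
qed

text \<open>Near \<open>z\<close> the functions eventually stay away from infinity or, if
  \<open>h z\<close> is infinite, from zero. In the second case the reciprocals converge, and
  \<open>q\<close> may vanish identically, meaning that \<open>h\<close> is infinite on the whole
  ball.\<close>

lemma spherical_limit_local_form:
  assumes f: "\<And>n. f n nicely_meromorphic_on ball z r" and r: "r > 0"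
    and ul: "uniform_limit (ball z r) (\<lambda>n w. stereo (ext_val (f n) w)) (\<lambda>w. stereo (h w)) sequentially"
  obtains \<rho> q where "0 < \<rho>" "\<rho> \<le> r" "q holomorphic_on ball z \<rho>"
    "(\<forall>w\<in>ball z \<rho>. h w = Some (q w)) \<or>
     (\<forall>w\<in>ball z \<rho>. h w = (if q w = 0 then None else Some (inverse (q w))))"
proof (cases "h z = None")
  case False
  then obtain \<rho> e N where \<rho>: "0 < \<rho>" "\<rho> \<le> r" and e: "e > 0"
    and fe: "\<And>n w. n \<ge> N \<Longrightarrow> w \<in> ball z \<rho> \<Longrightarrow> chordal (ext_val (f n) w) None \<ge> e"
    and he: "\<And>w. w \<in> ball z \<rho> \<Longrightarrow> chordal (h w) None \<ge> e"
    using eventually_away_from_value[OF f r ul, of None] by blast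
  have sub: "ball z \<rho> \<subseteq> ball z r" using \<rho> by auto
  define q where "q = (\<lambda>w. the (h w))"
  have hq: "h w = Some (q w)" if "w \<in> ball z \<rho>" for w
    using he[OF that] e by (cases "h w") (auto simp: q_def)
  have np: "\<not> is_pole (f n) w" if "n \<ge> N" "w \<in> ball z \<rho>" for n w
    using fe[OF that] e by (cases "is_pole (f n) w") auto
  have "q holomorphic_on ball z \<rho>"
  proof (rule holomorphic_spherical_limit[OF _ e])
    show "f n holomorphic_on ball z \<rho>" if "n \<ge> N" for n
    proof (rule analytic_imp_holomorphic)
      show "f n analytic_on ball z \<rho>"
        using nicely_meromorphic_on_imp_analytic_at[OF f] np[OF that] sub
        by (subst analytic_on_analytic_at) blast
    qed
    show "chordal (Some (f n w)) None \<ge> e" if "n \<ge> N" "w \<in> ball z \<rho>" for n w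
      using fe[OF that] np[OF that] by simp
    show "chordal (Some (q w)) None \<ge> e" if "w \<in> ball z \<rho>" for w
      using he[OF that] hq[OF that] by simp
    have "uniform_limit (ball z \<rho>) (\<lambda>n w. stereo (ext_val (f n) w)) (\<lambda>w. stereo (h w)) sequentially"
      by (rule uniform_limit_on_subset[OF ul sub])
    then show "uniform_limit (ball z \<rho>) (\<lambda>n w. stereo (Some (f n w))) (\<lambda>w. stereo (Some (q w))) sequentially"
      by (rule uniform_limit_cong[THEN iffD1, rotated 2])
         (use hq np in \<open>auto simp: eventually_sequentially intro!: exI[of _ N]\<close>)
  qed
  then show thesis using that \<rho> hq by blast
next
  case True
  then have "h z \<noteq> Some 0" by simp
  then obtain \<rho> e N where \<rho>: "0 < \<rho>" "\<rho> \<le> r" and e: "e > 0"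
    and fe: "\<And>n w. n \<ge> N \<Longrightarrow> w \<in> ball z \<rho> \<Longrightarrow> chordal (ext_val (f n) w) (Some 0) \<ge> e"
    and he: "\<And>w. w \<in> ball z \<rho> \<Longrightarrow> chordal (h w) (Some 0) \<ge> e"
    using eventually_away_from_value[OF f r ul, of "Some 0"] by blast
  have sub: "ball z \<rho> \<subseteq> ball z r" using \<rho> by auto
  define q where "q = (\<lambda>w. recip (h w))"
  have h0: "h w \<noteq> Some 0" if "w \<in> ball z \<rho>" for w
    using he[OF that] e by auto
  have f0: "ext_val (f n) w \<noteq> Some 0" if "n \<ge> N" "w \<in> ball z \<rho>" for n w
    using fe[OF that] e by auto
  have "q holomorphic_on ball z \<rho>"
  proof (rule holomorphic_spherical_limit[OF _ e])
    show "(\<lambda>w. recip (ext_val (f n) w)) holomorphic_on ball z \<rho>" if "n \<ge> N" for n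
      using f0[OF that] by (intro recip_ext_val_holomorphic nicely_meromorphic_on_subset[OF f sub]) auto
    show "chordal (Some (recip (ext_val (f n) w))) None \<ge> e" if "n \<ge> N" "w \<in> ball z \<rho>" for n w
      using fe[OF that] f0[OF that] chordal_recip(2) by metis
    show "chordal (Some (q w)) None \<ge> e" if "w \<in> ball z \<rho>" for w
      using he[OF that] h0[OF that] chordal_recip(2) unfolding q_def by metis
    show "uniform_limit (ball z \<rho>) (\<lambda>n w. stereo (Some (recip (ext_val (f n) w)))) (\<lambda>w. stereo (Some (q w))) sequentially"
    proof (rule uniform_limitI)
      fix \<epsilon> :: real assume "\<epsilon> > 0"
      from uniform_limitD[OF ul this] obtain M where M: "\<And>n w. n \<ge> M \<Longrightarrow> w \<in> ball z r \<Longrightarrow>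
          dist (stereo (ext_val (f n) w)) (stereo (h w)) < \<epsilon>"
        unfolding eventually_sequentially by blast
      have "dist (stereo (Some (recip (ext_val (f n) w)))) (stereo (Some (q w))) < \<epsilon>"
        if n: "n \<ge> max M N" and w: "w \<in> ball z \<rho>" for n w
        using M[of n w] n subsetD[OF sub w] chordal_recip(1)[OF f0[of n w] h0[OF w]] w
        by (simp add: chordal_eq_dist q_def del: chordal.simps)
      then show "\<forall>\<^sub>F n in sequentially. \<forall>w\<in>ball z \<rho>.
          dist (stereo (Some (recip (ext_val (f n) w)))) (stereo (Some (q w))) < \<epsilon>"
        unfolding eventually_sequentially by blast
    qed
  qed
  moreover have "h w = (if q w = 0 then None else Some (inverse (q w)))" if "w \<in> ball z \<rho>" for w
    using h0[OF that] by (cases "h w") (auto simp: q_def recip_def)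
  ultimately show thesis using that \<rho> by blast
qed

text \<open>The set \<open>E\<close> of points near which \<open>h\<close> is constantly infinite is
  open and closed in \<open>D\<close>, so it is empty or all of \<open>D\<close>. If it is empty,
  zeros of \<open>q\<close> in the reciprocal form are isolated and become poles.\<close>

lemma meromorphic_or_infinite:
  assumes D: "open D" "connected D"
    and loc: "\<And>z. z \<in> D \<Longrightarrow> \<exists>\<rho> q. 0 < \<rho> \<and> ball z \<rho> \<subseteq> D \<and> q holomorphic_on ball z \<rho> \<and>
      ((\<forall>w\<in>ball z \<rho>. h w = Some (q w)) \<or>
       (\<forall>w\<in>ball z \<rho>. h w = (if q w = 0 then None else Some (inverse (q w)))))"
  shows "(\<exists>g. g nicely_meromorphic_on D \<and> (\<forall>z\<in>D. h z = ext_val g z)) \<or> (\<forall>z\<in>D. h z = None)"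
proof -
  define E where "E = {z \<in> D. \<forall>\<^sub>F w in nhds z. h w = None}"
  have "open E"
  proof -
    have "open {z. \<forall>\<^sub>F w in nhds z. h w = None}"
      unfolding open_subopen[of "{z. \<forall>\<^sub>F w in nhds z. h w = None}"]
      by (auto simp: eventually_nhds)
    then show ?thesis unfolding E_def using D(1) by (simp add: Collect_conj_eq open_Int)
  qed
  \<comment> \<open>If the ball around \<open>z\<close> met \<open>E\<close>, then \<open>q\<close>
    would vanish on an open subset and, by the identity theorem, on the whole ball, placing
    \<open>z\<close> in \<open>E\<close>.\<close>
  have "open (D - E)"
  proof (rule openI)
    fix z assume z: "z \<in> D - E"
    then obtain \<rho> q where \<rho>: "0 < \<rho>" "ball z \<rho> \<subseteq> D" and q: "q holomorphic_on ball z \<rho>"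
      and hq: "(\<forall>w\<in>ball z \<rho>. h w = Some (q w)) \<or>
       (\<forall>w\<in>ball z \<rho>. h w = (if q w = 0 then None else Some (inverse (q w))))"
      using loc[of z] by auto
    have "w \<notin> E" if w: "w \<in> ball z \<rho>" for w
    proof
      assume "w \<in> E"
      then obtain U where U: "open U" "w \<in> U" "\<And>x. x \<in> U \<Longrightarrow> h x = None"
        by (auto simp: E_def eventually_nhds)
      have "\<not> (\<forall>w\<in>ball z \<rho>. h w = Some (q w))" using U w by force
      with hq have h: "\<And>x. x \<in> ball z \<rho> \<Longrightarrow> h x = (if q x = 0 then None else Some (inverse (q x)))"
        by blast
      have q0: "q x = 0" if "x \<in> ball z \<rho> \<inter> U" for x
        using h[of x] U(3)[of x] that by (auto split: if_splits)
      have "q x = 0" if "x \<in> ball z \<rho>" for x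
        by (rule analytic_continuation_open[of "ball z \<rho> \<inter> U" "ball z \<rho>" q "\<lambda>_. 0"])
           (use U w q q0 that in auto)
      then have "\<And>x. x \<in> ball z \<rho> \<Longrightarrow> h x = None" using h by simp
      then have "\<forall>\<^sub>F w in nhds z. h w = None"
        using \<rho>(1) by (auto simp: eventually_nhds intro!: exI[of _ "ball z \<rho>"])
      then show False using z by (simp add: E_def)
    qed
    then show "\<exists>e>0. ball z e \<subseteq> D - E" using \<rho> by blast
  qed
  have "E \<subseteq> D" by (auto simp: E_def)
  then have "E \<inter> D = {} \<or> (D - E) \<inter> D = {}"
    using connectedD[OF D(2) \<open>open E\<close> \<open>open (D - E)\<close>] by blast
  then show ?thesis
  proof
    assume "(D - E) \<inter> D = {}"
    then have "\<forall>z\<in>D. h z = None" by (auto simp: E_def dest: eventually_nhds_x_imp_x)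
    then show ?thesis ..
  next
    assume ED: "E \<inter> D = {}"
    \<comment> \<open>The value \<open>0\<close> at infinite points is the dummy value that
      \<open>nicely_meromorphic_on\<close> prescribes at poles; it also agrees with
      \<open>inverse 0\<close>.\<close>
    define g where "g = (\<lambda>z. case h z of None \<Rightarrow> 0 | Some c \<Rightarrow> c)"
    have key: "g nicely_meromorphic_on {z} \<and> h z = ext_val g z" if z: "z \<in> D" for z
    proof -
      obtain \<rho> q where \<rho>: "0 < \<rho>" "ball z \<rho> \<subseteq> D" and q: "q holomorphic_on ball z \<rho>"
        and hq: "(\<forall>w\<in>ball z \<rho>. h w = Some (q w)) \<or>
         (\<forall>w\<in>ball z \<rho>. h w = (if q w = 0 then None else Some (inverse (q w))))"
        using loc[OF z] by auto
      have an: "q analytic_on {z}" using q \<rho>(1) by (auto simp: analytic_on_def)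
      from hq show ?thesis
      proof
        assume h: "\<forall>w\<in>ball z \<rho>. h w = Some (q w)"
        have "g holomorphic_on ball z \<rho>"
          by (rule holomorphic_transform[OF q]) (use h in \<open>simp add: g_def\<close>)
        then have "g nicely_meromorphic_on {z}" "\<not> is_pole g z"
          using \<rho>(1) not_is_pole_holomorphic[of "ball z \<rho>" z g]
          by (auto intro!: analytic_on_imp_nicely_meromorphic_on simp: analytic_on_def)
        then show ?thesis using h \<rho>(1) by (simp add: g_def)
      next
        assume h: "\<forall>w\<in>ball z \<rho>. h w = (if q w = 0 then None else Some (inverse (q w)))"
        have gq: "g w = inverse (q w)" if "w \<in> ball z \<rho>" for w
          using h that by (simp add: g_def)
        have ev: "\<forall>\<^sub>F w in at z. g w = inverse (q w)"
          using \<rho>(1) by (intro eventually_mono[OF eventually_at_in_open'[of "ball z \<rho>" z]] gq) auto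
        have nice: "(\<lambda>w. inverse (q w)) nicely_meromorphic_on {z}"
          by (intro nicely_meromorphic_on_inverse analytic_on_imp_nicely_meromorphic_on an)
        have pole: "is_pole g z \<longleftrightarrow> is_pole (\<lambda>w. inverse (q w)) z"
          by (intro is_pole_cong ev refl)
        have "g \<midarrow>z\<rightarrow> g z \<longleftrightarrow> (\<lambda>w. inverse (q w)) \<midarrow>z\<rightarrow> inverse (q z)"
          using gq[of z] \<rho>(1) by (intro filterlim_cong ev) auto
        moreover have "g meromorphic_on {z} \<longleftrightarrow> (\<lambda>w. inverse (q w)) meromorphic_on {z}"
          using ev by (intro meromorphic_on_cong) auto
        ultimately have gn: "g nicely_meromorphic_on {z}"
          using nice gq[of z] \<rho>(1) by (simp add: nicely_meromorphic_on_def pole)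
        have "is_pole g z \<longleftrightarrow> q z = 0"
        proof
          assume "is_pole g z"
          then show "q z = 0"
            using an zero_isolated_zero_analytic by (auto simp: pole is_pole_inverse_iff)
        next
          \<comment> \<open>A zero of \<open>q\<close> that is not isolated would force
            \<open>q = 0\<close> near \<open>z\<close>, hence \<open>z \<in> E\<close>, which is
            excluded.\<close>
          assume q0: "q z = 0"
          show "is_pole g z"
          proof (rule ccontr)
            assume "\<not> is_pole g z"
            then have "\<forall>\<^sub>F w in nhds z. q w = 0"
              using non_isolated_zero_imp_eventually_zero'[OF an q0] by (simp add: pole is_pole_inverse_iff)
            moreover have "\<forall>\<^sub>F w in nhds z. w \<in> ball z \<rho>"
              using \<rho>(1) by (intro eventually_nhds_in_open) auto
            ultimately have "\<forall>\<^sub>F w in nhds z. h w = None"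
              by eventually_elim (use h in auto)
            then show False using z ED by (auto simp: E_def)
          qed
        qed
        then have "h z = ext_val g z"
          using h \<rho>(1) gq[of z] by (auto simp: ext_val_def)
        then show ?thesis using gn by simp
      qed
    qed
    have "g nicely_meromorphic_on D"
      unfolding nicely_meromorphic_on_def
      using key meromorphic_on_meromorphic_at[of g D] by (auto simp: nicely_meromorphic_on_def)
    then show ?thesis using key by blast
  qed
qed


section \<open>Compactness: an Arzela-Ascoli argument on the sphere\<close>

lemma uniformly_convergent_of_equilipschitz:
  fixes \<Phi> :: "nat \<Rightarrow> 'a::heine_borel \<Rightarrow> 'b::complete_space"
  assumes lip: "\<And>n x y. n \<ge> N \<Longrightarrow> x \<in> ball z r \<Longrightarrow> y \<in> ball z r \<Longrightarrow>
      dist (\<Phi> n x) (\<Phi> n y) \<le> L * dist x y"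
    and S: "\<And>U. open U \<Longrightarrow> U \<noteq> {} \<Longrightarrow> U \<subseteq> ball z r \<Longrightarrow> S \<inter> U \<noteq> {}"
    and conv: "\<And>x. x \<in> S \<Longrightarrow> convergent (\<lambda>n. \<Phi> n x)"
    and r: "r > 0"
  shows "uniformly_convergent_on (cball z (r / 2)) \<Phi>"
proof (rule Cauchy_uniformly_convergent, rule uniformly_Cauchy_onI)
  fix e :: real assume e: "e > 0"
  \<comment> \<open>A positive majorant of \<open>L\<close>, since \<open>L\<close> itself may be
    zero or negative.\<close>
  define l where "l = \<bar>L\<bar> + 1"
  have l: "l > 0" "L \<le> l" by (auto simp: l_def)
  define \<delta> where "\<delta> = e / (3 * l)"
  have \<delta>: "\<delta> > 0" using e l by (simp add: \<delta>_def)
  have L\<delta>: "L * d \<le> e / 3" if d: "0 \<le> d" "d \<le> \<delta>" for d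
  proof -
    have "L * d \<le> l * \<delta>" using d l by (intro mult_mono) auto
    also have "\<dots> = e / 3" using l by (simp add: \<delta>_def)
    finally show ?thesis .
  qed
  \<comment> \<open>Finitely many points of the dense set \<open>S\<close> are \<delta>-close to
    every point of the smaller ball; convergence at these and the Lipschitz bound give a
    three-epsilon estimate.\<close>
  have "cball z (r / 2) \<subseteq> (\<Union>s\<in>S \<inter> ball z r. ball s \<delta>)"
  proof
    fix x assume x: "x \<in> cball z (r / 2)"
    then have xr: "x \<in> ball z r" using r by simp
    have "S \<inter> (ball z r \<inter> ball x \<delta>) \<noteq> {}"
      using xr \<delta> by (intro S) auto
    then obtain s where "s \<in> S" "s \<in> ball z r" "s \<in> ball x \<delta>" by blast
    then show "x \<in> (\<Union>s\<in>S \<inter> ball z r. ball s \<delta>)" by (auto simp: dist_commute)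
  qed
  then obtain T where T: "T \<subseteq> S \<inter> ball z r" "finite T" "cball z (r / 2) \<subseteq> (\<Union>s\<in>T. ball s \<delta>)"
    by (rule compactE_image[OF compact_cball, rotated]) auto
  have "\<exists>M. \<forall>m\<ge>M. \<forall>n\<ge>M. dist (\<Phi> m s) (\<Phi> n s) < e / 3" if "s \<in> T" for s
  proof -
    have "Cauchy (\<lambda>n. \<Phi> n s)" using that T(1) by (intro convergent_Cauchy conv) auto
    then show ?thesis using e unfolding Cauchy_def by (meson divide_pos_pos zero_less_numeral)
  qed
  then obtain M where M: "\<And>s m n. s \<in> T \<Longrightarrow> m \<ge> M s \<Longrightarrow> n \<ge> M s \<Longrightarrow> dist (\<Phi> m s) (\<Phi> n s) < e / 3"
    by metis
  define K where "K = Max (insert N (M ` T))"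
  have K: "K \<ge> N" "\<And>s. s \<in> T \<Longrightarrow> K \<ge> M s"
    using T(2) by (auto simp: K_def)
  have "dist (\<Phi> m x) (\<Phi> n x) < e" if x: "x \<in> cball z (r / 2)" and mn: "m \<ge> K" "n \<ge> K" for x m n
  proof -
    obtain s where s: "s \<in> T" "x \<in> ball s \<delta>" using T(3) x by blast
    have xb: "x \<in> ball z r" "s \<in> ball z r" using x r s(1) T(1) by auto
    have "dist (\<Phi> k x) (\<Phi> k s) \<le> e / 3" if "k \<ge> K" for k
    proof -
      have "dist (\<Phi> k x) (\<Phi> k s) \<le> L * dist x s" using that K(1) xb by (intro lip) auto
      also have "\<dots> \<le> e / 3" using s(2) by (intro L\<delta>) (auto simp: dist_commute)
      finally show ?thesis .
    qed
    from this[OF mn(1)] this[OF mn(2)] show ?thesis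
      using M[OF s(1), of m n] K(2)[OF s(1)] mn
        dist_triangle[of "\<Phi> m x" "\<Phi> n x" "\<Phi> m s"] dist_triangle[of "\<Phi> m s" "\<Phi> n x" "\<Phi> n s"]
      by (simp add: dist_commute)
  qed
  then show "\<exists>M. \<forall>x\<in>cball z (r / 2). \<forall>m\<ge>M. \<forall>n\<ge>M. dist (\<Phi> m x) (\<Phi> n x) < e" by blast
qed

text \<open>A diagonal subsequence converges at every point of a countable dense set, all values
  lying on the bounded unit sphere. The Lipschitz bounds upgrade this to locally uniform
  convergence, and the limit is then identified as meromorphic or infinite.\<close>

lemma convergent_subsequence_of_locally_equilipschitz:
  fixes f :: "nat \<Rightarrow> complex \<Rightarrow> complex"
  assumes D: "open D" "connected D"
    and f: "\<And>n. f n nicely_meromorphic_on D"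
    and lip: "\<And>z. z \<in> D \<Longrightarrow> \<exists>r>0. \<exists>N L. ball z r \<subseteq> D \<and> (\<forall>n\<ge>N. \<forall>x\<in>ball z r. \<forall>y\<in>ball z r.
        chordal (ext_val (f n) x) (ext_val (f n) y) \<le> L * dist x y)"
  obtains k h where "strict_mono (k :: nat \<Rightarrow> nat)"
    "(\<exists>g. g nicely_meromorphic_on D \<and> h = ext_val g) \<or> h = (\<lambda>_. None)"
    "spherically_loc_unif_limit D (\<lambda>n. ext_val (f (k n))) h"
proof -
  obtain C :: "complex set" where C: "countable C" "\<And>U. open U \<Longrightarrow> U \<noteq> {} \<Longrightarrow> \<exists>d\<in>C. d \<in> U"
    by (erule countable_dense_setE)
  obtain k where k: "strict_mono (k :: nat \<Rightarrow> nat)"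
    and conv: "\<And>x. x \<in> C \<Longrightarrow> \<exists>l. (\<lambda>n. stereo (ext_val (f (k n)) x)) \<longlonglongrightarrow> l"
    using function_convergent_subsequence[OF C(1), of "\<lambda>n x. stereo (ext_val (f n) x)" 1]
    by (auto simp: norm_stereo)
  define \<Phi> where "\<Phi> = (\<lambda>n x. stereo (ext_val (f (k n)) x))"
  define H where "H = (\<lambda>x. lim (\<lambda>n. \<Phi> n x))"
  have unif: "\<exists>r>0. ball z r \<subseteq> D \<and> uniform_limit (ball z r) \<Phi> H sequentially" if z: "z \<in> D" for z
  proof -
    obtain r N L where r: "r > 0" "ball z r \<subseteq> D" and L: "\<And>n x y. n \<ge> N \<Longrightarrow> x \<in> ball z r \<Longrightarrow>
        y \<in> ball z r \<Longrightarrow> chordal (ext_val (f n) x) (ext_val (f n) y) \<le> L * dist x y"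
      using lip[OF z] by metis
    have "uniformly_convergent_on (cball z (r / 2)) \<Phi>"
    proof (rule uniformly_convergent_of_equilipschitz[where N = N and L = L and S = C])
      show "dist (\<Phi> n x) (\<Phi> n y) \<le> L * dist x y"
        if "n \<ge> N" "x \<in> ball z r" "y \<in> ball z r" for n x y
        using L[of "k n" x y] that seq_suble[OF k, of n] by (simp add: \<Phi>_def chordal_eq_dist)
      show "C \<inter> U \<noteq> {}" if "open U" "U \<noteq> {}" "U \<subseteq> ball z r" for U using C(2) that by blast
      show "convergent (\<lambda>n. \<Phi> n x)" if "x \<in> C" for x
        using conv[OF that] by (simp add: \<Phi>_def convergent_def)
    qed (use r in auto)
    then have "uniform_limit (cball z (r / 2)) \<Phi> H sequentially"
      by (simp add: uniformly_convergent_uniform_limit_iff H_def)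
    then have "uniform_limit (ball z (r / 2)) \<Phi> H sequentially"
      by (rule uniform_limit_on_subset) auto
    moreover have "ball z (r / 2) \<subseteq> D"
      by (rule order_trans[OF subset_ball r(2)]) (use r in simp)
    ultimately show ?thesis using r(1) by (intro exI[of _ "r / 2"]) auto
  qed
  \<comment> \<open>The limit stays on the sphere, so it comes from a map into the extended
    plane.\<close>
  have norm_H: "norm (H x) = 1" if x: "x \<in> D" for x
  proof -
    obtain r where r: "r > 0" "uniform_limit (ball x r) \<Phi> H sequentially" using unif[OF x] by blast
    then have "(\<lambda>n. \<Phi> n x) \<longlonglongrightarrow> H x" by (intro tendsto_uniform_limitI) auto
    then have "(\<lambda>n. norm (\<Phi> n x)) \<longlonglongrightarrow> norm (H x)" by (rule tendsto_norm)
    then show ?thesis by (simp add: \<Phi>_def norm_stereo LIMSEQ_const_iff)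
  qed
  \<comment> \<open>Meaningful on \<open>D\<close> only; elsewhere \<open>H\<close>, and with it the
    choice, is arbitrary.\<close>
  define h where "h = (\<lambda>x. SOME p. stereo p = H x)"
  have h: "stereo (h x) = H x" if "x \<in> D" for x
    unfolding h_def by (rule someI_ex) (use stereo_surj[OF norm_H[OF that]] in blast)
  have unif_h: "\<exists>r>0. ball z r \<subseteq> D \<and> uniform_limit (ball z r) \<Phi> (\<lambda>w. stereo (h w)) sequentially"
    if z: "z \<in> D" for z
  proof -
    obtain r where r: "r > 0" "ball z r \<subseteq> D" "uniform_limit (ball z r) \<Phi> H sequentially"
      using unif[OF z] by blast
    have "uniform_limit (ball z r) \<Phi> (\<lambda>w. stereo (h w)) sequentially"
      by (rule uniform_limit_cong'[THEN iffD1, OF _ _ r(3)]) (use h r(2) in \<open>auto simp: subset_iff\<close>)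
    then show ?thesis using r by blast
  qed
  have "(\<exists>g. g nicely_meromorphic_on D \<and> (\<forall>z\<in>D. h z = ext_val g z)) \<or> (\<forall>z\<in>D. h z = None)"
  proof (rule meromorphic_or_infinite[OF D])
    fix z assume z: "z \<in> D"
    obtain r where r: "r > 0" "ball z r \<subseteq> D"
      and ul: "uniform_limit (ball z r) (\<lambda>n w. stereo (ext_val (f (k n)) w)) (\<lambda>w. stereo (h w)) sequentially"
      using unif_h[OF z] unfolding \<Phi>_def by blast
    obtain \<rho> q where "0 < \<rho>" "\<rho> \<le> r" "q holomorphic_on ball z \<rho>"
      "(\<forall>w\<in>ball z \<rho>. h w = Some (q w)) \<or>
       (\<forall>w\<in>ball z \<rho>. h w = (if q w = 0 then None else Some (inverse (q w))))"
      by (rule spherical_limit_local_form[OF nicely_meromorphic_on_subset[OF f r(2)] r(1) ul])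
    moreover from this have "ball z \<rho> \<subseteq> D" using r(2) by auto
    ultimately show "\<exists>\<rho> q. 0 < \<rho> \<and> ball z \<rho> \<subseteq> D \<and> q holomorphic_on ball z \<rho> \<and>
      ((\<forall>w\<in>ball z \<rho>. h w = Some (q w)) \<or>
       (\<forall>w\<in>ball z \<rho>. h w = (if q w = 0 then None else Some (inverse (q w)))))"
      by blast
  qed
  \<comment> \<open>Normality demands a limit that equals \<open>ext_val g\<close> or infinity as a
    function on the whole plane, so \<open>h\<close> is exchanged for a map that agrees with it on
    \<open>D\<close>.\<close>
  then obtain h' where h': "(\<exists>g. g nicely_meromorphic_on D \<and> h' = ext_val g) \<or> h' = (\<lambda>_. None)"
    and hh': "\<And>z. z \<in> D \<Longrightarrow> h z = h' z"
  proof (elim disjE exE conjE)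
    fix g assume "g nicely_meromorphic_on D" "\<forall>z\<in>D. h z = ext_val g z"
    then show thesis using that[of "ext_val g"] by blast
  next
    assume "\<forall>z\<in>D. h z = None"
    then show thesis using that[of "\<lambda>_. None"] by simp
  qed
  have "spherically_loc_unif_limit D (\<lambda>n. ext_val (f (k n))) h'"
    unfolding spherically_loc_unif_limit_def
  proof
    fix z assume z: "z \<in> D"
    obtain r where r: "r > 0" "ball z r \<subseteq> D"
      and ul: "uniform_limit (ball z r) \<Phi> (\<lambda>w. stereo (h w)) sequentially"
      using unif_h[OF z] by blast
    have "uniform_limit (ball z r \<inter> D) (\<lambda>n w. chordal (ext_val (f (k n)) w) (h' w)) (\<lambda>_. 0) sequentially"
    proof (rule uniform_limitI)
      fix e :: real assume "e > 0"
      from uniform_limitD[OF ul this]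
      show "\<forall>\<^sub>F n in sequentially. \<forall>w\<in>ball z r \<inter> D. dist (chordal (ext_val (f (k n)) w) (h' w)) 0 < e"
        by eventually_elim (use hh' in \<open>auto simp: \<Phi>_def chordal_eq_dist\<close>)
    qed
    then show "\<exists>r>0. uniform_limit (ball z r \<inter> D)
        (\<lambda>n w. chordal (ext_val (f (k n)) w) (h' w)) (\<lambda>_. 0) sequentially"
      using r by blast
  qed
  then show thesis using that k h' by blast
qed

section \<open>Transfer of omitted values from the partners, and the conclusion\<close>

lemma locally_omits_value:
  assumes D: "open D" "z \<in> D"
    and h: "(\<exists>g. g nicely_meromorphic_on D \<and> h = ext_val g) \<or> h = (\<lambda>_. None)"
    and lim: "spherically_loc_unif_limit D G h" and p: "h z \<noteq> p"
  obtains r N where "r > 0" "ball z r \<subseteq> D" "\<And>n w. n \<ge> N \<Longrightarrow> w \<in> ball z r \<Longrightarrow> G n w \<noteq> p"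
proof -
  have cont: "isCont (\<lambda>w. stereo (h w)) z"
    using h continuous_stereo_ext_val[OF _ D] by auto
  \<comment> \<open>Half the distance from \<open>h z\<close> to \<open>p\<close>: one
    \<open>e\<close> pays for the variation of \<open>h\<close> near \<open>z\<close>, the other for
    the distance of \<open>G n\<close> to \<open>h\<close>.\<close>
  define e where "e = dist (stereo (h z)) (stereo p) / 2"
  have e: "e > 0" using p by (simp add: e_def stereo_inject)
  obtain d where d: "d > 0" "\<And>w. dist w z < d \<Longrightarrow> dist (stereo (h w)) (stereo (h z)) < e"
    using cont e unfolding continuous_at_eps_delta by blast
  obtain s where s: "s > 0" "uniform_limit (ball z s \<inter> D) (\<lambda>n w. chordal (G n w) (h w)) (\<lambda>_. 0) sequentially"
    using lim D(2) unfolding spherically_loc_unif_limit_def by blast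
  obtain N where N: "\<And>n w. n \<ge> N \<Longrightarrow> w \<in> ball z s \<inter> D \<Longrightarrow> dist (chordal (G n w) (h w)) 0 < e"
    using uniform_limitD[OF s(2) e] unfolding eventually_sequentially by blast
  obtain t where t: "t > 0" "ball z t \<subseteq> D" using D openE by blast
  define r where "r = min t (min d s)"
  have "G n w \<noteq> p" if n: "n \<ge> N" and w: "w \<in> ball z r" for n w
  proof
    assume "G n w = p"
    then have "dist (stereo p) (stereo (h w)) < e"
      using N[OF n, of w] w t(2) by (auto simp: r_def chordal_eq_dist subset_iff)
    moreover have "dist (stereo (h w)) (stereo (h z)) < e"
      using d(2) w by (simp add: r_def dist_commute)
    ultimately show False
      using dist_triangle[of "stereo (h z)" "stereo p" "stereo (h w)"]
      by (simp add: e_def dist_commute)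
  qed
  moreover have "r > 0" "ball z r \<subseteq> D" using t d s by (auto simp: r_def)
  ultimately show thesis using that by blast
qed

theorem theorem1p3:
  fixes D :: "complex set"
    and a1 a2 a3 a4 :: "complex option"
    and \<F> \<G> :: "(complex \<Rightarrow> complex) set"
  assumes "open D" "connected D" "D \<noteq> {}"
    and "distinct [a1, a2, a3, a4]"
    and "\<And>f. f \<in> \<F> \<Longrightarrow> f nicely_meromorphic_on D"
    and "\<And>g. g \<in> \<G> \<Longrightarrow> g nicely_meromorphic_on D"
    and "\<And>f z. f \<in> \<F> \<Longrightarrow> z \<in> apoints D f a1 \<Longrightarrow> apoint_mult f a1 z \<ge> 2"
    and "normal_family D \<G>"
    and "\<And>f. f \<in> \<F> \<Longrightarrow> \<exists>g\<in>\<G>. \<forall>a\<in>{a2, a3, a4}. share_partially D f g a"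
  shows "normal_family D \<F>"
  unfolding normal_family_def
proof (intro allI impI)
  fix f :: "nat \<Rightarrow> complex \<Rightarrow> complex" assume "range f \<subseteq> \<F>"
  then have fF: "\<And>n. f n \<in> \<F>" by blast
  have "\<forall>n. \<exists>g. g \<in> \<G> \<and> (\<forall>a\<in>{a2, a3, a4}. share_partially D (f n) g a)"
    using assms(9)[OF fF] by blast
  then obtain g where g: "\<And>n. g n \<in> \<G>" "\<And>n. \<forall>a\<in>{a2, a3, a4}. share_partially D (f n) (g n) a"
    by (auto dest!: choice)
  have "range g \<subseteq> \<G>" using g(1) by blast
  then obtain k h where k: "strict_mono (k :: nat \<Rightarrow> nat)"
    and h: "(\<exists>g. g nicely_meromorphic_on D \<and> h = ext_val g) \<or> h = (\<lambda>_. None)"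
    and lim: "spherically_loc_unif_limit D (\<lambda>n. ext_val (g (k n))) h"
    using assms(8) unfolding normal_family_def by blast
  have lip: "\<exists>r>0. \<exists>N L. ball z r \<subseteq> D \<and> (\<forall>n\<ge>N. \<forall>x\<in>ball z r. \<forall>y\<in>ball z r.
      chordal (ext_val (f (k n)) x) (ext_val (f (k n)) y) \<le> L * dist x y)" if z: "z \<in> D" for z
  proof -
    \<comment> \<open>The value \<open>h z\<close> equals at most one of the three shared values, so
      two others are left, and they may depend on \<open>z\<close>.\<close>
    obtain b c where bc: "b \<in> {a2, a3, a4}" "c \<in> {a2, a3, a4}" "b \<noteq> c" "h z \<noteq> b" "h z \<noteq> c"
      using assms(4) by (cases "h z = a2"; cases "h z = a3") auto
    obtain rb Nb where rb: "rb > 0" "ball z rb \<subseteq> D"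
      "\<And>n w. n \<ge> Nb \<Longrightarrow> w \<in> ball z rb \<Longrightarrow> ext_val (g (k n)) w \<noteq> b"
      using locally_omits_value[OF assms(1) z h lim bc(4)] by blast
    obtain rc Nc where rc: "rc > 0" "ball z rc \<subseteq> D"
      "\<And>n w. n \<ge> Nc \<Longrightarrow> w \<in> ball z rc \<Longrightarrow> ext_val (g (k n)) w \<noteq> c"
      using locally_omits_value[OF assms(1) z h lim bc(5)] by blast
    define r where "r = min rb rc"
    have r: "r > 0" "ball z r \<subseteq> D" using rb rc by (auto simp: r_def)
    have abc: "distinct [a1, b, c]" using bc assms(4) by auto
    \<comment> \<open>The constant is fixed before any function is chosen, so it serves all
      \<open>f (k n)\<close> at once.\<close>
    obtain L where "L > 0" and L: "\<And>f z0 r z w. r > 0 \<Longrightarrow> f nicely_meromorphic_on ball z0 r \<Longrightarrow>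
      (\<And>x. x \<in> ball z0 r \<Longrightarrow> ext_val f x \<noteq> b \<and> ext_val f x \<noteq> c) \<Longrightarrow>
      (\<And>x. x \<in> ball z0 r \<Longrightarrow> ext_val f x = a1 \<Longrightarrow> apoint_mult f a1 x \<ge> 2) \<Longrightarrow>
      z \<in> ball z0 (r / 2) \<Longrightarrow> w \<in> ball z0 (r / 2) \<Longrightarrow>
      chordal (ext_val f z) (ext_val f w) \<le> L / r * dist z w"
      using equilipschitz_of_two_omitted_one_ramified[OF abc] by blast
    have "chordal (ext_val (f (k n)) x) (ext_val (f (k n)) y) \<le> L / r * dist x y"
      if n: "n \<ge> max Nb Nc" and xy: "x \<in> ball z (r / 2)" "y \<in> ball z (r / 2)" for n x y
    proof (rule L[OF r(1) nicely_meromorphic_on_subset[OF assms(5)[OF fF] r(2)] _ _ xy])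
      fix w assume w: "w \<in> ball z r"
      then have wD: "w \<in> D" using r by blast
      \<comment> \<open>Partial sharing is used in its contrapositive form: a value omitted by the
        partner is omitted by \<open>f (k n)\<close>.\<close>
      have "ext_val (f (k n)) w \<noteq> a" if "a \<in> {a2, a3, a4}" "ext_val (g (k n)) w \<noteq> a" for a
        using bspec[OF g(2) that(1), of "k n"] that(2) wD by (auto simp: share_partially_def apoints_def)
      then show "ext_val (f (k n)) w \<noteq> b \<and> ext_val (f (k n)) w \<noteq> c"
        using bc rb(3)[of n w] rc(3)[of n w] n w by (simp add: r_def)
      show "apoint_mult (f (k n)) a1 w \<ge> 2" if "ext_val (f (k n)) w = a1"
        using assms(7)[OF fF] wD that by (simp add: apoints_def)
    qed
    moreover have "ball z (r / 2) \<subseteq> D"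
      by (rule order_trans[OF subset_ball r(2)]) (use r in simp)
    moreover have "r / 2 > 0" using r(1) by simp
    ultimately show ?thesis by blast
  qed
  obtain k' h' where k': "strict_mono (k' :: nat \<Rightarrow> nat)"
    and h': "(\<exists>g. g nicely_meromorphic_on D \<and> h' = ext_val g) \<or> h' = (\<lambda>_. None)"
    and lim': "spherically_loc_unif_limit D (\<lambda>n. ext_val (f (k (k' n)))) h'"
    by (rule convergent_subsequence_of_locally_equilipschitz[OF assms(1,2), of "\<lambda>n. f (k n)",
          OF assms(5)[OF fF] lip]) (assumption, (rule that; assumption))
  have "strict_mono (k \<circ> k')" using k k' by (rule strict_mono_o)
  then show "\<exists>(k :: nat \<Rightarrow> nat) h. strict_mono k \<and>
      ((\<exists>g. g nicely_meromorphic_on D \<and> h = ext_val g) \<or> h = (\<lambda>_. None)) \<and>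
      spherically_loc_unif_limit D (\<lambda>n. ext_val (f (k n))) h"
    using h' lim' by (intro exI[of _ "k \<circ> k'"] exI[of _ h']) simp
qed

end
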